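(* Let $f:\mathbb{N}\to[0,\infty)$ be of the form $f(x)=x^{r(x)}$, where $r$ decreases monotonically to $0$ as $x\to\infty$, and let $(a_n^{(f)})_{n\in\mathbb{N}}$ be the increasing enumeration of $\{n\in\mathbb{N}:P^-(n)>f(n)\}$. Let $\alpha$ be an irrational number satisfying $$\liminf_{n\to\infty} n\,\|n\alpha\|\,\log(f(n))=0 .$$ Then $(a_n^{(f)}\alpha)_{n\in\mathbb{N}}\pmod 1$ does not have Poissonian pair correlations. In particular, for every such $f$ and for Lebesgue-almost every $\alpha\in\mathbb{R}$, the sequence $(a_n^{(f)}\alpha)_{n\in\mathbb{N}}\pmod 1$ does not have Poissonian pair correlations (so it does not have Poissonian correlations of all orders).
   Context: Here $\|t\|$ is the distance from $t$ to the nearest integer and $P^-(n)$ is the smallest prime divisor of $n$ (with the usual convention $P^-(1)=\infty$). A sequence $(x_n)_{n\in\mathbb{N}}\subseteq[0,1)$ has Poissonian correlations of $k$-th order ($k\ge2$) if for every (bounded) axis-parallel rectangle $\boldsymbol{R}\subseteq\mathbb{R}^{k-1}$, $$\frac1N\#\Big\{\boldsymbol{n}\in[1,N]^k_{\neq}: (x_{n_1}-x_{n_2},\ldots,x_{n_1}-x_{n_k})\in\tfrac{1}{N}\boldsymbol{R}\Big\}\longrightarrow \mathrm{Vol}(\boldsymbol{R})\quad(N\to\infty),$$ where $[1,N]^k_{\neq}$ is the set of integer $k$-tuples with pairwise distinct entries in $\{1,\dots,N\}$ and $\mathrm{Vol}$ is $(k-1)$-dimensional Lebesgue measure. Poissonian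 pair correlations means Poissonian correlations of order $k=2$. *)

theory Defs
  imports "HOL-Analysis.Analysis" "HOL-Library.Infinite_Set" "HOL-Computational_Algebra.Primes"
begin

definition dist_nearest_int :: "real \<Rightarrow> real" where
  "dist_nearest_int t = \<bar>t - of_int (round t)\<bar>"

definition smallest_prime_divisor :: "nat \<Rightarrow> ereal" where
  "smallest_prime_divisor n =
     (if n = 1 then \<infinity> else ereal (real (LEAST p. prime p \<and> p dvd n)))"

definition rough_set :: "(nat \<Rightarrow> real) \<Rightarrow> nat set" where
  "rough_set f = {n. 1 \<le> n \<and> ereal (f n) < smallest_prime_divisor n}"

text \<open>Sequences are indexed from 1, whereas \<^const>\<open>enumerate\<close> counts from 0;
  the value at index 0 is never used.\<close>

definition rough_seq :: "(nat \<Rightarrow> real) \<Rightarrow> nat \<Rightarrow> nat" where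
  "rough_seq f n = enumerate (rough_set f) (n - 1)"

text \<open>A vector in (k - 1)-dimensional space is an extensional function on the index set
  \<open>{2..k}\<close>, its coordinate \<open>i\<close> being the one in which \<open>x (n 1) - x (n i)\<close> is placed.
  The sides of a rectangle may be open, closed or half-open.\<close>

definition rectangles :: "nat \<Rightarrow> (nat \<Rightarrow> real) set set" where
  "rectangles k =
     {PiE {2..k} I | I. \<forall>i\<in>{2..k}. is_interval (I i) \<and> bounded (I i)}"

definition distinct_tuples :: "nat \<Rightarrow> nat \<Rightarrow> (nat \<Rightarrow> nat) set" where
  "distinct_tuples k N = {n \<in> {1..k} \<rightarrow>\<^sub>E {1..N}. inj_on n {1..k}}"

text \<open>The differences are real differences, not taken modulo 1.\<close>

definition poissonian_correlations :: "nat \<Rightarrow> (nat \<Rightarrow> real) \<Rightarrow> bool" where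
  "poissonian_correlations k x \<longleftrightarrow>
     (\<forall>R\<in>rectangles k.
        (\<lambda>N. real (card {n \<in> distinct_tuples k N.
                 (\<lambda>i\<in>{2..k}. real N * (x (n 1) - x (n i))) \<in> R}) / real N)
          \<longlonglongrightarrow> measure (\<Pi>\<^sub>M i\<in>{2..k}. lborel) R)"

abbreviation poissonian_pair_correlations :: "(nat \<Rightarrow> real) \<Rightarrow> bool" where
  "poissonian_pair_correlations \<equiv> poissonian_correlations 2"

end

theory Submission
  imports Defs
begin

text \<open>Let \<open>N\<close> be the number of \<open>f\<close>-rough integers up to \<open>M\<close>. If \<open>16 d \<le> N\<close> and \<open>M \<parallel>d\<alpha>\<parallel>\<close> is small, the
  pigeonhole principle, applied to residue classes modulo \<open>d\<close> cut into intervals of length about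
  \<open>8 d M / N\<close>, yields at least \<open>N\<close> ordered pairs at distance at most \<open>16 M \<parallel>d\<alpha>\<parallel> / N\<close>, far more than a
  Poissonian sequence has. Only a lower bound for \<open>N\<close> enters. When \<open>ln f\<close> is bounded below, one
  takes \<open>d = q\<close> with \<open>q \<parallel>q\<alpha>\<parallel> ln (f q)\<close> small and \<open>M\<close> of order \<open>q ln (f q)\<close>, and \<open>N\<close> is of order at least
  \<open>M / ln (f q)\<close> by Mertens-type estimates. Otherwise there are arbitrarily large \<open>q\<close> such that all
  integers in \<open>[q, q\<^sup>2]\<close> are rough, and the Poissonian hypothesis itself supplies a suitable \<open>d\<close>.

  For almost all \<open>\<alpha>\<close>, the divergence case of Khinchin's theorem bounds \<open>n \<parallel>n\<alpha>\<parallel> ln n\<close> along a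
  subsequence, and \<open>ln (f n) = r n * ln n\<close> with \<open>r\<close> tending to 0.\<close>

section \<open>Elementary prime number estimates\<close>

text \<open>The pigeonhole needs \<open>d \<le> N / 16\<close> and
  \<open>M * dist_nearest_int (d * \<alpha>) \<le> 1 / 128\<close>, so
  \<open>d * dist_nearest_int (d * \<alpha>)\<close> has to be small against the density
  \<open>N / M\<close>. With a density of order at least \<open>1 / ln f\<close>, this is what the
  liminf condition provides. The obstacle is that \<open>f\<close> may be close to 1, or equal to 1
  where \<open>r\<close> vanishes: then \<open>ln (f n)\<close> is itself small, and the condition
  can hold without \<open>n * dist_nearest_int (n * \<alpha>)\<close> being small, even for badly
  approximable \<open>\<alpha>\<close>. A dichotomy helps there. A Poissonian sequence contains
  pairs at every scale \<open>s / N\<close>, however small \<open>s\<close> is; but the difference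
  \<open>d\<close> of a single such pair, repeated along a run of consecutive integers longer by a
  constant factor, produces too many pairs at scale \<open>1 / 8\<close>. So small gaps are either
  missing or too frequent.\<close>

definition chebyshev_theta :: "nat \<Rightarrow> real" where
  "chebyshev_theta n = (\<Sum>p | prime p \<and> p \<le> n. ln (real p))"

definition mertens_sum :: "nat \<Rightarrow> real" where
  "mertens_sum n = (\<Sum>p | prime p \<and> p \<le> n. ln (real p) / real p)"

section \<open>Chebyshev's upper bound for the theta function\<close>

lemma prod_primes_dvd:
  fixes m :: nat
  assumes "finite S" "\<And>p. p \<in> S \<Longrightarrow> prime p" "\<And>p. p \<in> S \<Longrightarrow> p dvd m"
  shows "\<Prod>S dvd m"
  using assms
proof (induction S rule: finite_induct)
  case (insert p S)
  have "coprime p (\<Prod>S)"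
    using insert by (intro prod_coprime_right) (metis insertCI primes_coprime)
  then show ?case
    using insert by (simp add: divides_mult)
qed auto

lemma sum_ln_prod_primes:
  fixes S :: "nat set"
  assumes "finite S" "\<And>p. p \<in> S \<Longrightarrow> prime p"
  shows "(\<Sum>p\<in>S. ln (real p)) = ln (real (\<Prod>S))"
proof -
  have "ln (\<Prod>p\<in>S. real p) = (\<Sum>p\<in>S. ln (real p))"
    using assms by (intro ln_prod) (auto dest: prime_gt_0_nat)
  then show ?thesis by simp
qed

lemma sum_ln_prime_divisors_le:
  fixes n :: nat
  assumes "finite S" "\<And>p. p \<in> S \<Longrightarrow> prime p" "\<And>p. p \<in> S \<Longrightarrow> p dvd n" "n > 0"
  shows "(\<Sum>p\<in>S. ln (real p)) \<le> ln (real n)"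
proof -
  have "\<Prod>S dvd n" using prod_primes_dvd assms by blast
  then have "\<Prod>S \<le> n" "\<Prod>S > 0" using \<open>n > 0\<close> by (auto intro: dvd_imp_le dvd_pos_nat)
  have "(\<Sum>p\<in>S. ln (real p)) = ln (real (\<Prod>S))"
    using sum_ln_prod_primes assms by blast
  also have "\<dots> \<le> ln (real n)"
    using \<open>\<Prod>S \<le> n\<close> \<open>\<Prod>S > 0\<close> by (intro ln_mono) (simp_all only: of_nat_0_less_iff of_nat_le_iff)
  finally show ?thesis .
qed

text \<open>The two middle coefficients of row \<open>2 * m + 1\<close> are equal, and together they
  are at most the row sum \<open>2 * 4 ^ m\<close>.\<close>

lemma binomial_odd_le: "(2 * m + 1) choose m \<le> 4 ^ m"
proof -
  have "2 * ((2 * m + 1) choose m) = ((2 * m + 1) choose m) + ((2 * m + 1) choose (m + 1))"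
    using binomial_symmetric[of m "2*m+1"] by simp
  also have "\<dots> = (\<Sum>k\<in>{m, m+1}. (2 * m + 1) choose k)" by simp
  also have "\<dots> \<le> (\<Sum>k\<le>2 * m + 1. (2 * m + 1) choose k)"
    by (intro sum_mono2) auto
  also have "\<dots> = 2 * 4 ^ m"
    by (simp only: choose_row_sum) (simp add: power_mult)
  finally show ?thesis by simp
qed

lemma prime_dvd_binomial_odd:
  assumes "prime p" "m + 1 < p" "p \<le> 2 * m + 1"
  shows "p dvd ((2 * m + 1) choose m)"
proof -
  have "fact m * fact (m + 1) * ((2 * m + 1) choose m) = (fact (2 * m + 1) :: nat)"
    using binomial_fact_lemma[of m "2*m+1"] by simp
  moreover have "p dvd (fact (2 * m + 1) :: nat)" "\<not> p dvd (fact m :: nat)" "\<not> p dvd (fact (m + 1) :: nat)"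
    using assms by (auto simp only: prime_dvd_fact_iff)
  ultimately show ?thesis
    using assms(1) by (metis prime_dvd_mult_iff)
qed

text \<open>Erdos's induction: the primes in \<open>(m + 1, 2 * m + 1]\<close> all divide one
  binomial coefficient, which is at most \<open>4 ^ m\<close>, so \<open>n = 2 * m + 1\<close>
  reduces to \<open>m + 1\<close>. An even \<open>n > 2\<close> is not prime and reduces to
  \<open>n - 1\<close>.\<close>

lemma chebyshev_theta_le: "chebyshev_theta n \<le> real n * ln 4"
proof (induction n rule: less_induct)
  case (less n)
  consider "n \<le> 1" | "n = 2" | "n > 2" "even n" | m where "n = 2 * m + 1" "m \<ge> 1"
    by (metis One_nat_def Suc_leI add.commute add_0_right le_less_linear less_one linorder_neqE_nat mult_0_right
        nat_less_le neq0_conv oddE one_add_one plus_1_eq_Suc Suc_1 less_2_cases_iff)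
  then show ?case
  proof cases
    case 1
    then have "{p. prime p \<and> p \<le> n} = {}" by (auto dest: prime_gt_1_nat)
    then have "chebyshev_theta n = 0" by (simp only: chebyshev_theta_def sum.empty)
    then show ?thesis by simp
  next
    case 2
    have "{p. prime p \<and> p \<le> (2::nat)} = {2}" by (auto dest: prime_ge_2_nat)
    then have "chebyshev_theta 2 = ln 2" by (simp add: chebyshev_theta_def)
    also have "\<dots> \<le> 2 * ln 4" using ln_mono[of 2 "4::real"] ln_ge_zero[of "4::real"] by linarith
    finally show ?thesis using 2 by simp
  next
    case 3
    have "\<not> prime n" using 3 by (metis prime_odd_nat)
    then have "{p. prime p \<and> p \<le> n} = {p. prime p \<and> p \<le> n - 1}"
      by (metis (no_types, opaque_lifting) Suc_pred' le_Suc_eq less_imp_le_nat 3(1) not_gr_zero not_less_zero)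
    then have "chebyshev_theta n = chebyshev_theta (n - 1)" by (simp add: chebyshev_theta_def)
    also have "\<dots> \<le> real (n - 1) * ln 4" using 3 by (intro less) simp
    also have "\<dots> \<le> real n * ln 4" by (intro mult_right_mono) auto
    finally show ?thesis .
  next
    case 4
    let ?Q = "{p. prime p \<and> m + 1 < p \<and> p \<le> 2 * m + 1}"
    have split: "{p. prime p \<and> p \<le> n} = {p. prime p \<and> p \<le> m + 1} \<union> ?Q"
      using 4 by auto
    have "chebyshev_theta n = chebyshev_theta (m + 1) + (\<Sum>p\<in>?Q. ln (real p))"
      unfolding chebyshev_theta_def split by (rule sum.union_disjoint) auto
    also have "(\<Sum>p\<in>?Q. ln (real p)) \<le> ln (real ((2 * m + 1) choose m))"
      
    proof (rule sum_ln_prime_divisors_le)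
      show "p dvd ((2 * m + 1) choose m)" if "p \<in> ?Q" for p
        using that prime_dvd_binomial_odd by blast
    qed auto
    also have "\<dots> \<le> ln (real (4 ^ m))"
      using binomial_odd_le[of m] by (subst ln_le_cancel_iff) (simp_all only: of_nat_0_less_iff of_nat_le_iff zero_less_binomial_iff, auto)
    also have "\<dots> = real m * ln 4" by (simp add: ln_realpow)
    also have "chebyshev_theta (m + 1) \<le> real (m + 1) * ln 4"
      using 4 by (intro less) auto
    finally show ?thesis using 4 by (simp add: algebra_simps)
  qed
qed

section \<open>Legendre's formula and the logarithm of the factorial\<close>

lemma multiplicity_eq_card:
  fixes p m n :: nat
  assumes "prime p" "1 \<le> m" "m \<le> n"
  shows "multiplicity p m = card {k\<in>{1..n}. p ^ k dvd m}"
proof -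
  have "{k\<in>{1..n}. p ^ k dvd m} = {1..multiplicity p m}"
  proof -
    have dvd: "p ^ k dvd m \<longleftrightarrow> k \<le> multiplicity p m" for k
      using assms power_dvd_iff_le_multiplicity[of m p k] by (auto dest: prime_gt_1_nat)
    have le: "multiplicity p m \<le> n"
    proof -
      have "p ^ multiplicity p m \<le> m" using assms by (intro dvd_imp_le multiplicity_dvd) auto
      moreover have "multiplicity p m < p ^ multiplicity p m"
        using assms by (intro power_gt_expt prime_gt_Suc_0_nat)
      ultimately show ?thesis using assms by linarith
    qed
    show ?thesis unfolding dvd using le by (simp add: set_eq_iff) linarith
  qed
  then show ?thesis by simp
qed

lemma card_multiples:
  fixes d n :: nat
  assumes "d > 0"
  shows "card {m\<in>{1..n}. d dvd m} = n div d"
proof -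
  have "{m\<in>{1..n}. d dvd m} = (\<lambda>k. d * k) ` {1..n div d}"
    using assms by (auto simp: less_eq_div_iff_mult_less_eq mult.commute elim!: dvdE)
  then show ?thesis using assms by (simp add: card_image inj_on_def)
qed

text \<open>Legendre's formula for the exponent of \<open>p\<close> in \<open>n!\<close>: both sides
  count the pairs \<open>(m, k)\<close> with \<open>p ^ k dvd m\<close>. The crude range
  \<open>{1..n}\<close> for \<open>k\<close> is the same for all \<open>m\<close>, which permits
  exchanging the sums.\<close>

lemma sum_multiplicity:
  fixes p n :: nat
  assumes "prime p"
  shows "(\<Sum>m=1..n. multiplicity p m) = (\<Sum>k=1..n. n div p ^ k)"
proof -
  have "(\<Sum>m=1..n. multiplicity p m) = (\<Sum>m=1..n. card {k\<in>{1..n}. p ^ k dvd m})"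
    using assms by (intro sum.cong refl multiplicity_eq_card) auto
  also have "\<dots> = (\<Sum>m=1..n. \<Sum>k=1..n. if p ^ k dvd m then 1 else 0)"
    by (simp add: sum.If_cases Int_def)
  also have "\<dots> = (\<Sum>k=1..n. \<Sum>m=1..n. if p ^ k dvd m then 1 else 0)"
    by (rule sum.swap)
  also have "\<dots> = (\<Sum>k=1..n. card {m\<in>{1..n}. p ^ k dvd m})"
    by (simp add: sum.If_cases Int_def)
  also have "\<dots> = (\<Sum>k=1..n. n div p ^ k)"
    using assms by (intro sum.cong refl card_multiples) (auto dest: prime_gt_0_nat)
  finally show ?thesis .
qed

lemma ln_eq_sum_multiplicity:
  fixes m n :: nat
  assumes "1 \<le> m" "m \<le> n"
  shows "ln (real m) = (\<Sum>p | prime p \<and> p \<le> n. real (multiplicity p m) * ln (real p))"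
proof -
  have "ln (real m) = ln (\<Prod>p\<in>prime_factors m. real p ^ multiplicity p m)"
    using assms by (subst prime_factorization_nat[of m]) auto
  also have "\<dots> = (\<Sum>p\<in>prime_factors m. ln (real p ^ multiplicity p m))"
    by (rule ln_prod) (auto dest: in_prime_factors_imp_prime prime_gt_0_nat)
  also have "\<dots> = (\<Sum>p\<in>prime_factors m. real (multiplicity p m) * ln (real p))"
    by (intro sum.cong refl ln_realpow)
  also have "\<dots> = (\<Sum>p | prime p \<and> p \<le> n. real (multiplicity p m) * ln (real p))"
  proof (rule sum.mono_neutral_left)
    show "prime_factors m \<subseteq> {p. prime p \<and> p \<le> n}"
      using assms by (auto simp: prime_factors_dvd dest!: dvd_imp_le)
    show "\<forall>i\<in>{p. prime p \<and> p \<le> n} - prime_factors m. real (multiplicity i m) * ln (real i) = 0"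
      using assms by (auto simp: prime_factors_dvd not_dvd_imp_multiplicity_0)
  qed auto
  finally show ?thesis .
qed

lemma ln_fact_eq:
  "ln (fact n :: real) = (\<Sum>p | prime p \<and> p \<le> n. real (\<Sum>k=1..n. n div p ^ k) * ln (real p))"
proof -
  have "ln (fact n :: real) = (\<Sum>m=1..n. ln (real m))"
    by (simp only: fact_prod of_nat_prod) (rule ln_prod, auto)
  also have "\<dots> = (\<Sum>m=1..n. \<Sum>p | prime p \<and> p \<le> n. real (multiplicity p m) * ln (real p))"
    by (intro sum.cong refl ln_eq_sum_multiplicity) auto
  also have "\<dots> = (\<Sum>p | prime p \<and> p \<le> n. \<Sum>m=1..n. real (multiplicity p m) * ln (real p))"
    by (rule sum.swap)
  also have "\<dots> = (\<Sum>p | prime p \<and> p \<le> n. real (\<Sum>m=1..n. multiplicity p m) * ln (real p))"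
    by (simp add: sum_distrib_right)
  also have "\<dots> = (\<Sum>p | prime p \<and> p \<le> n. real (\<Sum>k=1..n. n div p ^ k) * ln (real p))"
    by (intro sum.cong refl) (simp only: sum_multiplicity mem_Collect_eq)
  finally show ?thesis .
qed

section \<open>Weak Stirling bounds and Mertens' first theorem\<close>

lemma ln_fact_le: "ln (fact n :: real) \<le> real n * ln (real n)"
proof (cases "n = 0")
  case False
  have "(fact n :: real) \<le> real n ^ n" using fact_le_power[of n] by simp
  then have "ln (fact n :: real) \<le> ln (real n ^ n)" using False by (subst ln_le_cancel_iff) auto
  then show ?thesis using False by (simp add: ln_realpow)
qed auto

lemma ln_fact_ge: "ln (fact n :: real) \<ge> real n * ln (real n) - real n"
proof (induction n)
  case (Suc n)
  show ?case
  proof (cases "n = 0")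
    case False
    then have n: "n > 0" by simp
    have "ln (real (Suc n)) - ln (real n) = ln (1 + 1 / real n)"
      using n by (simp add: add_divide_distrib add.commute flip: ln_divide_pos)
    also have "\<dots> \<le> 1 / real n" by (rule ln_add_one_self_le_self) simp
    finally have "real n * (ln (real (Suc n)) - ln (real n)) \<le> 1"
      using n by (simp add: field_simps)
    moreover have "ln (fact (Suc n) :: real) = ln (real (Suc n)) + ln (fact n)"
      using ln_mult[of "real (Suc n)" "fact n"] by simp
    ultimately show ?thesis using Suc by (simp add: algebra_simps)
  qed auto
qed auto

text \<open>In Legendre's formula only the term \<open>k = 1\<close> is kept, and
  \<open>n div p\<close> is at least \<open>n / p - 1\<close>. The loss of 1 per prime adds up to
  \<open>chebyshev_theta n\<close>, whence the \<open>ln 4\<close>.\<close>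

lemma mertens_sum_le:
  assumes "n \<ge> 1"
  shows "mertens_sum n \<le> ln (real n) + ln 4"
proof -
  have "real n * mertens_sum n - chebyshev_theta n = (\<Sum>p | prime p \<and> p \<le> n. (real n / real p - 1) * ln (real p))"
    by (simp add: mertens_sum_def chebyshev_theta_def sum_distrib_left flip: sum_subtractf)
       (simp add: algebra_simps)
  also have "\<dots> \<le> (\<Sum>p | prime p \<and> p \<le> n. real (\<Sum>k=1..n. n div p ^ k) * ln (real p))"
  proof (intro sum_mono mult_right_mono)
    fix p assume p: "p \<in> {p. prime p \<and> p \<le> n}"
    have "real n / real p - 1 \<le> real (n div p)"
      using floor_correct[of "real n / real p"] by (simp add: floor_divide_of_nat_eq)
    also have "n div p = (\<Sum>k\<in>{1}. n div p ^ k)" by simp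
    also have "\<dots> \<le> (\<Sum>k=1..n. n div p ^ k)" using assms by (intro sum_mono2) auto
    finally show "real n / real p - 1 \<le> real (\<Sum>k=1..n. n div p ^ k)" by simp
    show "0 \<le> ln (real p)" using p by (auto dest: prime_ge_1_nat)
  qed
  also have "\<dots> = ln (fact n)" by (rule ln_fact_eq[symmetric])
  also have "\<dots> \<le> real n * ln (real n)" by (rule ln_fact_le)
  finally have "real n * mertens_sum n \<le> real n * (ln (real n) + ln 4)"
    using chebyshev_theta_le[of n] by (simp add: algebra_simps)
  then show ?thesis using assms by simp
qed

lemma sum_ln_over_square_le:
  "(\<Sum>k=2..n. ln (real k) / (real k * (real k - 1))) \<le> 4"
proof (cases "n \<ge> 2")
  case True
  \<comment> \<open>The tail of the integral of \<open>ln t / t\<^sup>2\<close> from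
    \<open>n\<close> on is \<open>(ln n + 1) / n\<close>; doubling it absorbs the difference between
    the sum and the integral and makes the induction close.\<close>
  then have "(\<Sum>k=2..n. ln (real k) / (real k * (real k - 1))) \<le> 4 - (2 * ln (real n) + 2) / real n"
  proof (induction n rule: dec_induct)
    case base
    have "ln 2 \<le> (1::real)" using ln_le_minus_one[of 2] by simp
    then show ?case by (simp add: field_simps)
  next
    case (step n)
    have n: "real n \<ge> 2" using step by simp
    have "ln (1 + 1 / real n) \<le> 1 / real n" by (rule ln_add_one_self_le_self) simp
    moreover have "ln (1 + 1 / real n) = ln (real n + 1) - ln (real n)"
      using n by (simp add: add_divide_distrib flip: ln_divide_pos)
    ultimately have *: "ln (real n + 1) \<le> ln (real n) + 1 / real n" by simp
    have "ln (real n) \<ge> 0" using n by simp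
    have "ln (real n + 1) / ((real n + 1) * real n) + (2 * ln (real n + 1) + 2) / (real n + 1)
        = ((1 + 2 * real n) * ln (real n + 1) + 2 * real n) / (real n * (real n + 1))"
      (is "?a / _ + _ = _")
    proof -
      have "(2 * ?a + 2) / (real n + 1) = ((2 * ?a + 2) * real n) / ((real n + 1) * real n)"
        using n by simp
      then show ?thesis by (simp add: add_divide_distrib[symmetric] algebra_simps)
    qed
    also have "\<dots> \<le> ((1 + 2 * real n) * (ln (real n) + 1 / real n) + 2 * real n) / (real n * (real n + 1))"
      using n * by (intro divide_right_mono add_mono mult_left_mono) auto
    also have "\<dots> \<le> (2 * ln (real n) + 2) / real n"
    proof -
      have "ln (real n) \<ge> ln 2" using n by simp
      moreover have "ln 2 \<ge> (1/2 :: real)" using ln2_ge_two_thirds by linarith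
      moreover have "1 / real n \<le> 1/2" using n by (simp add: field_simps)
      ultimately have "1 / real n \<le> ln (real n)" by linarith
      then have "(1 + 2 * real n) * (ln (real n) + 1 / real n) + 2 * real n \<le> (2 * ln (real n) + 2) * (real n + 1)"
        using n by (simp add: field_simps)
      then have "((1 + 2 * real n) * (ln (real n) + 1 / real n) + 2 * real n) / (real n * (real n + 1))
          \<le> ((2 * ln (real n) + 2) * (real n + 1)) / (real n * (real n + 1))"
        using n by (intro divide_right_mono) auto
      also have "\<dots> = (2 * ln (real n) + 2) / real n" using n by simp
      finally show ?thesis .
    qed
    finally show ?case using step n by (simp add: algebra_simps)
  qed
  moreover have "(2 * ln (real n) + 2) / real n \<ge> 0" using True by simp
  ultimately show ?thesis by linarith
qed auto

lemma real_div_le: "real (n div d) \<le> real n / real d"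
  using floor_correct[of "real n / real d"] by (simp add: floor_divide_of_nat_eq)

lemma sum_inverse_powers_le:
  fixes x :: real
  assumes "x > 1"
  shows "(\<Sum>k=1..n. 1 / x ^ k) \<le> 1 / (x - 1)"
proof -
  have "(\<Sum>k=1..n. 1 / x ^ k) = (1 - 1 / x ^ n) / (x - 1)"
  proof (induction n)
    case (Suc n)
    have "1 / x ^ Suc n = (1 / x ^ n - 1 / x ^ Suc n) / (x - 1)"
      using assms by (simp add: field_simps)
    moreover have "(\<Sum>k=1..Suc n. 1 / x ^ k) = (\<Sum>k=1..n. 1 / x ^ k) + 1 / x ^ Suc n" by simp
    ultimately show ?case using Suc by (simp only: diff_divide_distrib)
  qed auto
  then show ?thesis using assms by (simp add: divide_right_mono)
qed

text \<open>The geometric series over \<open>k\<close> gives \<open>n / (p - 1)\<close>, that is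
  \<open>n / p\<close> plus \<open>n / (p * (p - 1))\<close>. The second part contributes at most
  \<open>4 * n\<close> in total, and Stirling loses another \<open>n\<close>: hence 5.\<close>

lemma mertens_sum_ge:
  assumes "n \<ge> 1"
  shows "mertens_sum n \<ge> ln (real n) - 5"
proof -
  have "real n * ln (real n) - real n \<le> ln (fact n)" by (rule ln_fact_ge)
  also have "\<dots> = (\<Sum>p | prime p \<and> p \<le> n. real (\<Sum>k=1..n. n div p ^ k) * ln (real p))"
    by (rule ln_fact_eq)
  also have "\<dots> \<le> (\<Sum>p | prime p \<and> p \<le> n. (real n / (real p - 1)) * ln (real p))"
  proof (intro sum_mono mult_right_mono)
    fix p assume p: "p \<in> {p. prime p \<and> p \<le> n}"
    then have p2: "p \<ge> 2" by (auto dest: prime_ge_2_nat)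
    have "real (\<Sum>k=1..n. n div p ^ k) \<le> (\<Sum>k=1..n. real n * (1 / real p ^ k))"
      unfolding of_nat_sum
    proof (rule sum_mono)
      show "real (n div p ^ k) \<le> real n * (1 / real p ^ k)" for k
        using real_div_le[of n "p ^ k"] by simp
    qed
    also have "\<dots> = real n * (\<Sum>k=1..n. 1 / real p ^ k)" by (rule sum_distrib_left[symmetric])
    also have "\<dots> \<le> real n * (1 / (real p - 1))"
      using p2 by (intro mult_left_mono sum_inverse_powers_le) auto
    finally show "real (\<Sum>k=1..n. n div p ^ k) \<le> real n / (real p - 1)" by simp
    show "0 \<le> ln (real p)" using p2 by simp
  qed
  also have "\<dots> = real n * (mertens_sum n + (\<Sum>p | prime p \<and> p \<le> n. ln (real p) / (real p * (real p - 1))))"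
  proof -
    have "real n / (real p - 1) * ln (real p) =
        real n * (ln (real p) / real p + ln (real p) / (real p * (real p - 1)))" if "prime p" for p
    proof -
      have p: "real p > 1" using that by (auto dest: prime_gt_1_nat)
      have "1 / (real p - 1) = 1 / real p + 1 / (real p * (real p - 1))"
        using p by (simp add: field_simps)
      then have "real n * ln (real p) * (1 / (real p - 1)) = real n * ln (real p) * (1 / real p + 1 / (real p * (real p - 1)))"
        by (rule arg_cong)
      then show ?thesis by (simp add: algebra_simps)
    qed
    then show ?thesis
      by (simp add: mertens_sum_def sum_distrib_left flip: sum.distrib)
  qed
  also have "(\<Sum>p | prime p \<and> p \<le> n. ln (real p) / (real p * (real p - 1))) \<le>
      (\<Sum>k=2..n. ln (real k) / (real k * (real k - 1)))"
    by (rule sum_mono2) (auto dest: prime_ge_2_nat)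
  also have "\<dots> \<le> 4" by (rule sum_ln_over_square_le)
  finally have "real n * ln (real n) - real n \<le> real n * (mertens_sum n + 4)"
    by (simp add: mult_left_mono)
  then have "real n * (ln (real n) - 1) \<le> real n * (mertens_sum n + 4)"
    by (simp add: algebra_simps)
  then show ?thesis using assms by simp
qed

text \<open>Mertens' first theorem has bounded error, so for a large ratio \<open>D\<close> the
  primes in \<open>(y / D, y]\<close> carry a weight \<open>ln p / p\<close> of at least 1. There
  \<open>p \<ge> y / D\<close>, so multiplying by \<open>y / D\<close> turns this into a bound for
  the sum of \<open>ln p\<close>. The value \<open>6 + ln 4\<close> leaves 1 after the errors 5 and
  \<open>ln 4\<close> of the two halves.\<close>

lemma sum_ln_primes_between_ge:
  "\<exists>c>0. \<exists>D\<ge>1. \<forall>y z::nat. z \<ge> 1 \<longrightarrow> D * z \<le> y \<longrightarrow>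
     c * real y \<le> (\<Sum>p | prime p \<and> z < p \<and> p \<le> y. ln (real p))"
proof -
  obtain D :: nat where D: "real D \<ge> exp (6 + ln 4)"
    using real_arch_simple by blast
  have "0 < real D" by (rule less_le_trans[OF exp_gt_zero D])
  then have D1: "D \<ge> 1" by simp
  have lnD: "ln (real D) \<ge> 6 + ln 4" 
    using D \<open>0 < real D\<close> by (subst ln_ge_iff) auto
  have "1 / real D * real y \<le> (\<Sum>p | prime p \<and> z < p \<and> p \<le> y. ln (real p))"
    if z: "z \<ge> 1" "D * z \<le> y" for y z
  proof -
    define w where "w = y div D"
    have zw: "z \<le> w" using z D1 by (simp add: w_def less_eq_div_iff_mult_less_eq mult.commute)
    then have w1: "w \<ge> 1" using z by simp
    have wy: "w \<le> y" by (simp add: w_def)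
    have wle: "real w \<le> real y / real D" unfolding w_def by (rule real_div_le)
    have y0: "real y > 0" using w1 wy by simp
    have split: "{p. prime p \<and> p \<le> y} = {p. prime p \<and> p \<le> w} \<union> {p. prime p \<and> w < p \<and> p \<le> y}"
      using wy by auto
    have "mertens_sum y = mertens_sum w + (\<Sum>p | prime p \<and> w < p \<and> p \<le> y. ln (real p) / real p)"
      unfolding mertens_sum_def split by (rule sum.union_disjoint) auto
    moreover have "mertens_sum y \<ge> ln (real y) - 5" using w1 wy by (intro mertens_sum_ge) simp
    moreover have "mertens_sum w \<le> ln (real w) + ln 4" using w1 by (rule mertens_sum_le)
    moreover have "ln (real w) \<le> ln (real y / real D)" using wle w1 by (intro ln_mono) auto
    moreover have "ln (real y / real D) = ln (real y) - ln (real D)"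
      using y0 \<open>0 < real D\<close> by (simp add: ln_divide_pos)
    ultimately have "1 \<le> (\<Sum>p | prime p \<and> w < p \<and> p \<le> y. ln (real p) / real p)"
      using lnD by linarith
    then have "real y / real D * 1 \<le> real y / real D * (\<Sum>p | prime p \<and> w < p \<and> p \<le> y. ln (real p) / real p)"
      by (intro mult_left_mono) auto
    also have "\<dots> = (\<Sum>p | prime p \<and> w < p \<and> p \<le> y. real y / real D * (ln (real p) / real p))"
      by (rule sum_distrib_left)
    also have "\<dots> \<le> (\<Sum>p | prime p \<and> w < p \<and> p \<le> y. ln (real p))"
    proof (rule sum_mono)
      fix p assume "p \<in> {p. prime p \<and> w < p \<and> p \<le> y}"
      then have p: "prime p" "w < p" by auto
      have "real y / real D \<le> real p"
      proof -
        have "y < D * p" using p(2) D1 by (simp add: w_def div_less_iff_less_mult mult.commute)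
        then have "real y \<le> real D * real p" by (simp flip: of_nat_mult)
        then show ?thesis using D1 by (simp add: field_simps)
      qed
      then have "real y / real D * (ln (real p) / real p) \<le> real p * (ln (real p) / real p)"
        using prime_ge_1_nat[OF p(1)] by (intro mult_right_mono) auto
      then show "real y / real D * (ln (real p) / real p) \<le> ln (real p)"
        using prime_gt_0_nat[OF p(1)] by simp
    qed
    also have "\<dots> \<le> (\<Sum>p | prime p \<and> z < p \<and> p \<le> y. ln (real p))"
      using zw by (intro sum_mono2) (auto dest: prime_ge_1_nat)
    finally show ?thesis by simp
  qed
  moreover have "1 / real D > 0" using D1 by simp
  ultimately show ?thesis using D1 by blast
qed

section \<open>Mertens' second and third theorems, as one-sided bounds\<close>

lemma mertens_sum_Suc:
  "mertens_sum (Suc n) = mertens_sum n + (if prime (Suc n) then ln (real (Suc n)) / real (Suc n) else 0)"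
proof -
  have "{p. prime p \<and> p \<le> Suc n} = (if prime (Suc n) then insert (Suc n) {p. prime p \<and> p \<le> n} else {p. prime p \<and> p \<le> n})"
    using le_Suc_eq by auto
  then show ?thesis by (auto simp: mertens_sum_def)
qed

lemma sum_inverse_primes_Suc:
  "(\<Sum>p | prime p \<and> p \<le> Suc n. 1 / real p) =
     (\<Sum>p | prime p \<and> p \<le> n. 1 / real p) + (if prime (Suc n) then 1 / real (Suc n) else 0)"
proof -
  have "{p. prime p \<and> p \<le> Suc n} = (if prime (Suc n) then insert (Suc n) {p. prime p \<and> p \<le> n} else {p. prime p \<and> p \<le> n})"
    using le_Suc_eq by auto
  then show ?thesis by auto
qed

text \<open>Summation by parts, with the weight \<open>1 / ln n\<close> and the partial sums of \<open>ln p / p\<close>;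
  the discrete analogue of \<open>\<integral> dt / (t ln t) = ln ln t\<close> is \<open>1 - 1 / u \<le> ln u\<close>.\<close>

lemma sum_inverse_primes_le:
  "\<exists>C. \<forall>n\<ge>2. (\<Sum>p | prime p \<and> p \<le> n. 1 / real p) \<le> ln (ln (real n)) + C"
proof -
  define C :: real where "C = 1 - ln (ln 2) + ln 4 / ln 2"
  have "(\<Sum>p | prime p \<and> p \<le> n. 1 / real p) - mertens_sum n / ln (real n)
      \<le> ln (ln (real n)) - ln (ln 2) + ln 4 / ln 2 - ln 4 / ln (real n)" if "n \<ge> 2" for n
    using that
  proof (induction n rule: dec_induct)
    case base
    have "{p. prime p \<and> p \<le> (2::nat)} = {2}" by (auto dest: prime_ge_2_nat)
    then show ?case by (simp add: mertens_sum_def)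
  next
    case (step n)
    define a b where "a = ln (real n)" and "b = ln (real (Suc n))"
    have ab: "0 < a" "a \<le> b" using step by (auto simp: a_def b_def)
    have "mertens_sum n \<le> a + ln 4" unfolding a_def using step by (intro mertens_sum_le) simp
    then have "mertens_sum n * (1 / a - 1 / b) \<le> (a + ln 4) * (1 / a - 1 / b)"
      using ab by (intro mult_right_mono) (auto simp: field_simps)
    also have "\<dots> = (1 - a / b) + ln 4 / a - ln 4 / b" using ab by (simp add: field_simps)
    also have "1 - a / b \<le> ln b - ln a"
    proof -
      have "ln (a / b) \<le> a / b - 1" using ab by (intro ln_le_minus_one) auto
      then show ?thesis using ab by (simp add: ln_divide_pos)
    qed
    finally have *: "mertens_sum n / a - mertens_sum n / b \<le> ln b - ln a + ln 4 / a - ln 4 / b"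
      by (simp add: algebra_simps)
    \<comment> \<open>If \<open>Suc n\<close> is prime, it adds \<open>1 / Suc n\<close> to both
      terms of the difference, as \<open>b = ln (Suc n)\<close>. These cancel, and only the change
      of weight from \<open>1 / a\<close> to \<open>1 / b\<close> remains.\<close>
    have "(\<Sum>p | prime p \<and> p \<le> Suc n. 1 / real p) - mertens_sum (Suc n) / b
        = (\<Sum>p | prime p \<and> p \<le> n. 1 / real p) - mertens_sum n / b"
      using ab unfolding sum_inverse_primes_Suc mertens_sum_Suc b_def[symmetric]
      by (simp add: add_divide_distrib)
    then show ?case using step.IH * by (simp add: a_def b_def)
  qed
  note bound = this
  have quotient: "mertens_sum n / ln (real n) \<le> 1 + ln 4 / ln (real n)" if "n \<ge> 2" for n
    using mertens_sum_le[of n] that by (simp add: field_simps)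
  have "(\<Sum>p | prime p \<and> p \<le> n. 1 / real p) \<le> ln (ln (real n)) + C" if "n \<ge> 2" for n
    using bound[OF that] quotient[OF that] unfolding C_def by linarith
  then show ?thesis by blast
qed

lemma sum_inverse_squares_le: "(\<Sum>k=2..n. 1 / (real k)\<^sup>2) \<le> 1"
proof (cases "n \<ge> 2")
  case True
  then have "(\<Sum>k=2..n. 1 / (real k)\<^sup>2) \<le> 1 - 1 / real n"
  proof (induction n rule: dec_induct)
    case (step n)
    have "1 / (real (Suc n))\<^sup>2 \<le> 1 / (real n * real (Suc n))"
      using step by (intro divide_left_mono) (auto simp: power2_eq_square)
    also have "\<dots> = 1 / real n - 1 / real (Suc n)" using step by (simp add: field_simps)
    finally show ?case using step by simp
  qed (simp add: power2_eq_square)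
  then show ?thesis by (smt (verit) divide_nonneg_nonneg of_nat_0_le_iff)
qed auto

text \<open>The inequality \<open>ln (1 - x) \<ge> - x - 2 * x\<^sup>2\<close>, valid up to
  \<open>x = 1 / 2\<close> and hence for \<open>p = 2\<close> as well, reduces the product to the
  sum of \<open>1 / p\<close> and a sum of squares bounded by 1; the latter is the 2 in
  \<open>exp (- C - 2)\<close>.\<close>

lemma prod_one_minus_inverse_primes_ge:
  "\<exists>c>0. \<forall>n\<ge>2. (\<Prod>p | prime p \<and> p \<le> n. 1 - 1 / real p) \<ge> c / ln (real n)"
proof -
  obtain C where C: "\<And>n. n \<ge> 2 \<Longrightarrow> (\<Sum>p | prime p \<and> p \<le> n. 1 / real p) \<le> ln (ln (real n)) + C"
    using sum_inverse_primes_le by blast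
  have "(\<Prod>p | prime p \<and> p \<le> n. 1 - 1 / real p) \<ge> exp (- C - 2) / ln (real n)" if n: "n \<ge> 2" for n
  proof -
    have "exp (- C - 2) / ln (real n) = exp (- (ln (ln (real n)) + C) - 2)"
      using n by (simp add: exp_minus exp_diff exp_add field_simps)
    also have "\<dots> \<le> exp (- (\<Sum>p | prime p \<and> p \<le> n. 1 / real p) - 2 * (\<Sum>p | prime p \<and> p \<le> n. 1 / (real p)\<^sup>2))"
    proof -
      have "(\<Sum>p | prime p \<and> p \<le> n. 1 / (real p)\<^sup>2) \<le> (\<Sum>k=2..n. 1 / (real k)\<^sup>2)"
        by (rule sum_mono2) (auto dest: prime_ge_2_nat)
      then show ?thesis using C[OF n] sum_inverse_squares_le[of n] by simp
    qed
    also have "\<dots> = (\<Prod>p | prime p \<and> p \<le> n. exp (- (1 / real p) - 2 * (1 / real p)\<^sup>2))"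
      by (simp add: sum_negf sum_subtractf sum_distrib_left power_divide flip: exp_sum)
    also have "\<dots> \<le> (\<Prod>p | prime p \<and> p \<le> n. 1 - 1 / real p)"
    proof (rule prod_mono, safe)
      fix p :: nat assume "prime p"
      then have p: "real p \<ge> 2" by (auto dest: prime_ge_2_nat)
      have "- (1 / real p) - 2 * (1 / real p)\<^sup>2 \<le> ln (1 - 1 / real p)"
        using p by (intro ln_one_minus_pos_lower_bound) (auto simp: field_simps)
      then show "exp (- (1 / real p) - 2 * (1 / real p)\<^sup>2) \<le> 1 - 1 / real p"
        using p by (subst (asm) ln_ge_iff) auto
    qed auto
    finally show ?thesis .
  qed
  then show ?thesis by (intro exI[of _ "exp (- C - 2)"]) auto
qed

section \<open>Counting rough numbers\<close>

text \<open>Weights \<open>1 / n\<close> avoid the rounding errors of counting: since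
  \<open>p\<close> is coprime to the primes in \<open>S\<close>, the multiples of \<open>p\<close>
  that survive \<open>S\<close> are \<open>p\<close> times the survivors up to
  \<open>x div p\<close>, and so carry at most the fraction \<open>1 / p\<close> of the whole
  weight. Each prime therefore costs at most its Euler factor.\<close>

lemma sum_inverse_not_dvd_ge:
  fixes S :: "nat set"
  assumes "finite S" "\<And>p. p \<in> S \<Longrightarrow> prime p"
  shows "(\<Prod>p\<in>S. 1 - 1 / real p) * harm x \<le> (\<Sum>n | n \<in> {1..x} \<and> (\<forall>p\<in>S. \<not> p dvd n). 1 / real n)"
  using assms
proof (induction S arbitrary: x rule: finite_induct)
  case empty
  have "{1..x} = {n. n \<in> {1..x} \<and> (\<forall>p\<in>{}. \<not> p dvd n)}" by auto
  then show ?case by (simp only: harm_def inverse_eq_divide prod.empty mult_1)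
next
  case (insert p S)
  define A where "A x = {n \<in> {1..x}. \<forall>q\<in>S. \<not> q dvd n}" for x :: nat
  have fin: "finite (A x)" for x by (simp add: A_def)
  have p: "prime p" using insert by auto
  then have p0: "p > 0" by (rule prime_gt_0_nat)
  have Aeq: "{n \<in> A x. p dvd n} = (\<lambda>m. p * m) ` A (x div p)"
  proof -
    have dvd: "q dvd p * m \<longleftrightarrow> q dvd m" if "q \<in> S" for q m
    proof -
      have "coprime q p" using that insert by (metis insertCI primes_coprime)
      then show ?thesis by (simp add: coprime_dvd_mult_right_iff)
    qed
    have mem: "p * m \<in> A x \<longleftrightarrow> m \<in> A (x div p)" for m
      using p0 dvd by (auto simp: A_def less_eq_div_iff_mult_less_eq mult.commute[of m p] Suc_le_eq)
    show ?thesis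
    proof (intro equalityI subsetI)
      fix n assume "n \<in> {n \<in> A x. p dvd n}"
      then obtain m where "n = p * m" "p * m \<in> A x" by (auto elim: dvdE)
      then show "n \<in> (\<lambda>m. p * m) ` A (x div p)" using mem by blast
    qed (use mem in auto)
  qed
  have "(\<Sum>n\<in>{n \<in> A x. p dvd n}. 1 / real n) = (\<Sum>m\<in>A (x div p). 1 / real (p * m))"
    unfolding Aeq using p0 by (subst sum.reindex) (auto simp: inj_on_def)
  also have "\<dots> = (1 / real p) * (\<Sum>m\<in>A (x div p). 1 / real m)"
    by (simp add: sum_distrib_left)
  also have "\<dots> \<le> (1 / real p) * (\<Sum>m\<in>A x. 1 / real m)"
    by (intro mult_left_mono sum_mono2 fin) (auto simp: A_def intro: order.trans[OF _ div_le_dividend])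
  finally have 1: "(\<Sum>n\<in>{n \<in> A x. p dvd n}. 1 / real n) \<le> (1 / real p) * (\<Sum>m\<in>A x. 1 / real m)" .
  have "(\<Sum>n\<in>A x. 1 / real n) = (\<Sum>n\<in>{n \<in> A x. p dvd n}. 1 / real n) + (\<Sum>n\<in>{n \<in> A x. \<not> p dvd n}. 1 / real n)"
    using fin by (subst sum.union_disjoint[symmetric]) (auto intro!: sum.cong)
  with 1 have "(1 - 1 / real p) * (\<Sum>n\<in>A x. 1 / real n) \<le> (\<Sum>n\<in>{n \<in> A x. \<not> p dvd n}. 1 / real n)"
    by (simp add: algebra_simps)
  moreover have "(1 - 1 / real p) * ((\<Prod>p\<in>S. 1 - 1 / real p) * harm x) \<le> (1 - 1 / real p) * (\<Sum>n\<in>A x. 1 / real n)"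
    using p0 insert by (intro mult_left_mono) (auto simp: A_def)
  moreover have "{n \<in> A x. \<not> p dvd n} = {n. n \<in> {1..x} \<and> (\<forall>q\<in>insert p S. \<not> q dvd n)}"
    by (auto simp: A_def)
  ultimately show ?case using insert.hyps by (simp add: mult.assoc)
qed

text \<open>The threshold \<open>z\<close> is constant here, while in \<open>rough_set f\<close> it
  varies with the number; \<open>card_rough_set_ge\<close> passes from one to the other.\<close>

definition rough_upto :: "nat \<Rightarrow> nat \<Rightarrow> nat set" where
  "rough_upto x z = {n \<in> {1..x}. \<forall>p. prime p \<and> p dvd n \<longrightarrow> z < p}"

lemma finite_rough_upto [simp]: "finite (rough_upto x z)"
  by (simp add: rough_upto_def)

text \<open>Every \<open>m * p\<close> with \<open>m\<close> rough and \<open>p > z\<close> prime is rough, and each rough \<open>n\<close> receives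
  total weight \<open>\<Sum>\<^bsub>p dvd n\<^esub> ln p \<le> ln n\<close>.\<close>

lemma sum_rough_primes_le:
  "(\<Sum>m\<in>rough_upto x z. \<Sum>p | prime p \<and> z < p \<and> p \<le> x div m. ln (real p))
     \<le> real (card (rough_upto x z)) * ln (real x)"
proof -
  let ?R = "rough_upto x z"
  let ?P = "SIGMA m:?R. {p. prime p \<and> z < p \<and> p \<le> x div m}"
  let ?Q = "SIGMA n:?R. {p. prime p \<and> p dvd n}"
  have finQ: "finite {p. prime p \<and> p dvd n}" if "n \<in> ?R" for n
    by (rule finite_subset[of _ "{..n}"]) (use that in \<open>auto simp: rough_upto_def dest: dvd_imp_le\<close>)
  have "(\<Sum>m\<in>?R. \<Sum>p | prime p \<and> z < p \<and> p \<le> x div m. ln (real p)) = (\<Sum>(m, p)\<in>?P. ln (real p))"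
    by (rule sum.Sigma) auto
  also have "\<dots> = (\<Sum>(n, p)\<in>(\<lambda>(m, p). (m * p, p)) ` ?P. ln (real p))"
    by (subst sum.reindex) (auto simp: inj_on_def o_def case_prod_beta dest: prime_gt_0_nat)
  also have "\<dots> \<le> (\<Sum>(n, p)\<in>?Q. ln (real p))"
  proof (rule sum_mono2)
    show "finite ?Q" by (intro finite_SigmaI finQ) auto
    show "(\<lambda>(m, p). (m * p, p)) ` ?P \<subseteq> ?Q"
    proof safe
      fix m p assume m: "m \<in> ?R" and p: "prime p" "z < p" "p \<le> x div m"
      have m1: "m \<ge> 1" using m by (simp add: rough_upto_def)
      have "p * m \<le> x" using p(3) m1 by (simp add: less_eq_div_iff_mult_less_eq)
      then show "m * p \<in> ?R"
        using m m1 p prime_gt_0_nat[OF p(1)]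
        by (auto simp: rough_upto_def mult.commute prime_dvd_mult_iff dest: primes_dvd_imp_eq)
    qed auto
    show "0 \<le> (case b of (n, p) \<Rightarrow> ln (real p))" if "b \<in> ?Q - (\<lambda>(m, p). (m * p, p)) ` ?P" for b
      using that by (auto dest: prime_ge_1_nat)
  qed
  also have "\<dots> = (\<Sum>n\<in>?R. \<Sum>p | prime p \<and> p dvd n. ln (real p))"
    by (rule sum.Sigma[symmetric]) (use finQ in auto)
  also have "\<dots> \<le> (\<Sum>n\<in>?R. ln (real x))"
  proof (rule sum_mono)
    fix n assume n: "n \<in> ?R"
    have "(\<Sum>p | prime p \<and> p dvd n. ln (real p)) \<le> ln (real n)"
      by (rule sum_ln_prime_divisors_le) (use n finQ in \<open>auto simp: rough_upto_def\<close>)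
    also have "\<dots> \<le> ln (real x)" using n by (auto simp: rough_upto_def)
    finally show "(\<Sum>p | prime p \<and> p dvd n. ln (real p)) \<le> ln (real x)" .
  qed
  finally show ?thesis by simp
qed

text \<open>This converts logarithmic weight into a count. In \<open>sum_rough_primes_le\<close>
  each rough \<open>m \<le> y\<close> contributes at least \<open>c * x / (2 * m)\<close>, and the
  rough \<open>m \<le> y\<close> have total weight of order at least \<open>ln x / ln z\<close>. The
  factor \<open>ln x\<close> cancels against the one on the right of
  \<open>sum_rough_primes_le\<close>.\<close>

lemma card_rough_upto_ge:
  "\<exists>c>0. \<exists>C\<ge>1. \<forall>x z::nat. z \<ge> 2 \<longrightarrow> C * z\<^sup>2 \<le> x \<longrightarrow>
     c * real x / ln (real z) \<le> real (card (rough_upto x z))"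
proof -
  obtain c :: real and E :: nat where c: "c > 0" and E: "E \<ge> 1" and
    cE: "\<And>y z. z \<ge> 1 \<Longrightarrow> E * z \<le> y \<Longrightarrow> c * real y \<le> (\<Sum>p | prime p \<and> z < p \<and> p \<le> y. ln (real p))"
    using sum_ln_primes_between_ge by metis
  obtain d where d: "d > 0" and
    dm: "\<And>n. n \<ge> 2 \<Longrightarrow> d / ln (real n) \<le> (\<Prod>p | prime p \<and> p \<le> n. 1 - 1 / real p)"
    using prod_one_minus_inverse_primes_ge by blast
  have "c * d / 4 * real x / ln (real z) \<le> real (card (rough_upto x z))"
    if z: "z \<ge> 2" and x: "E\<^sup>2 * z\<^sup>2 \<le> x" for x z
  proof -
    \<comment> \<open>For \<open>m \<le> y\<close> one has \<open>x div m \<ge> E * z\<close>, the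
      range in which primes above \<open>z\<close> are plentiful. As
      \<open>x \<ge> (E * z)\<^sup>2\<close>, \<open>y + 1\<close> still exceeds the square root of
      \<open>x\<close>, so that \<open>ln x\<close> is only halved.\<close>
    define y where "y = x div (E * z)"
    have Ez: "E * z \<ge> 2" using E z mult_le_mono[of 1 E 2 z] by simp
    have Ezx: "(E * z) * (E * z) \<le> x" using x by (simp add: power2_eq_square ac_simps)
    have x4: "x \<ge> 4" using mult_le_mono[OF Ez Ez] Ezx by linarith
    have lnz: "ln (real z) > 0" using z by simp
    have lnx: "ln (real x) > 0" using x4 by simp
    have "real x < (real y + 1) * real (E * z)"
    proof -
      have "x < (y + 1) * (E * z)" 
      proof -
        have "0 < E * z" using Ez by linarith
        then have "x < E * z + E * z * (x div (E * z))" by (rule dividend_less_times_div)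
        then show ?thesis by (simp add: y_def algebra_simps)
      qed
      then show ?thesis by (metis of_nat_1 of_nat_add of_nat_less_iff of_nat_mult)
    qed
    then have "ln (real x) < ln ((real y + 1) * real (E * z))"
      using x4 by (subst ln_less_cancel_iff) auto
    also have "\<dots> = ln (real y + 1) + ln (real (E * z))"
      using Ez by (intro ln_mult_pos) (auto simp only: of_nat_0_less_iff)
    also have "ln (real (E * z)) \<le> ln (real x) / 2"
    proof -
      have "ln (real (E * z)) + ln (real (E * z)) = ln (real (E * z) * real (E * z))"
        using Ez by (intro ln_mult_pos[symmetric]) (auto simp only: of_nat_0_less_iff)
      also have "\<dots> \<le> ln (real x)" using Ezx Ez E z by (intro ln_mono) (simp_all only: of_nat_mult[symmetric] of_nat_le_iff of_nat_0_less_iff, auto)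
      finally show ?thesis by linarith
    qed
    finally have lny: "ln (real x) / 2 \<le> ln (real y + 1)" by linarith
    have Rxy: "rough_upto y z \<subseteq> rough_upto x z"
      by (auto simp: rough_upto_def y_def intro: order.trans[OF _ div_le_dividend])
    have eq: "{n. n \<in> {1..y} \<and> (\<forall>p\<in>{p. prime p \<and> p \<le> z}. \<not> p dvd n)} = rough_upto y z"
      by (auto simp: rough_upto_def not_less)
    have "d / ln (real z) * (ln (real x) / 2) \<le> (\<Prod>p | prime p \<and> p \<le> z. 1 - 1 / real p) * harm y"
    proof (rule mult_mono)
      show "ln (real x) / 2 \<le> harm y" using lny harm_ge_ln[of y] by linarith
      have "0 \<le> d / ln (real z)" using d lnz by simp
      then show "0 \<le> (\<Prod>p | prime p \<and> p \<le> z. 1 - 1 / real p)" using dm[OF z] by linarith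
    qed (use dm[OF z] lnx in auto)
    also have "\<dots> \<le> (\<Sum>n\<in>rough_upto y z. 1 / real n)"
      unfolding eq[symmetric] by (rule sum_inverse_not_dvd_ge) auto
    finally have "c * real x / 2 * (d / ln (real z) * (ln (real x) / 2)) \<le> c * real x / 2 * (\<Sum>n\<in>rough_upto y z. 1 / real n)"
      using c by (intro mult_left_mono) auto
    also have "\<dots> = (\<Sum>m\<in>rough_upto y z. c * real x / 2 * (1 / real m))" by (rule sum_distrib_left)
    also have "\<dots> \<le> (\<Sum>m\<in>rough_upto y z. \<Sum>p | prime p \<and> z < p \<and> p \<le> x div m. ln (real p))"
    proof (rule sum_mono)
      fix m assume "m \<in> rough_upto y z"
      then have m: "m \<ge> 1" "m \<le> y" by (auto simp: rough_upto_def)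
      have "0 < E * z" using Ez by linarith
      then have "m * (E * z) \<le> x" using m(2) unfolding y_def by (simp only: less_eq_div_iff_mult_less_eq)
      then have le: "E * z \<le> x div m" using m(1) by (simp add: less_eq_div_iff_mult_less_eq mult.commute)
      then have "x div m \<ge> 1" using Ez by linarith
      moreover have "real x < (real (x div m) + 1) * real m"
      proof -
        have "x < (x div m + 1) * m" using m(1) dividend_less_times_div[of m x]
          by (simp add: algebra_simps)
        then show ?thesis by (metis of_nat_1 of_nat_add of_nat_less_iff of_nat_mult)
      qed
      ultimately have "real x / real m \<le> 2 * real (x div m)"
      proof -
        assume "x div m \<ge> 1" "real x < (real (x div m) + 1) * real m"
        then have "real x / real m \<le> real (x div m) + 1" using m(1) by (simp add: field_simps)
        with \<open>x div m \<ge> 1\<close> show ?thesis by linarith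
      qed
      then have "c / 2 * (real x / real m) \<le> c / 2 * (2 * real (x div m))"
        using c by (intro mult_left_mono) auto
      also have "c / 2 * (2 * real (x div m)) = c * real (x div m)" by simp
      also have "\<dots> \<le> (\<Sum>p | prime p \<and> z < p \<and> p \<le> x div m. ln (real p))"
        using z le by (intro cE) auto
      finally show "c * real x / 2 * (1 / real m) \<le> (\<Sum>p | prime p \<and> z < p \<and> p \<le> x div m. ln (real p))"
        by simp
    qed
    also have "\<dots> \<le> (\<Sum>m\<in>rough_upto x z. \<Sum>p | prime p \<and> z < p \<and> p \<le> x div m. ln (real p))"
      using Rxy by (intro sum_mono2 sum_nonneg) (auto dest: prime_ge_1_nat)
    also have "\<dots> \<le> real (card (rough_upto x z)) * ln (real x)" by (rule sum_rough_primes_le)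
    finally have "c * d / 4 * real x / ln (real z) * ln (real x) \<le> real (card (rough_upto x z)) * ln (real x)"
      by (simp add: field_simps)
    then show ?thesis by (rule mult_right_le_imp_le[OF _ lnx])
  qed
  moreover have "c * d / 4 > 0" "E\<^sup>2 \<ge> 1" using c d E by auto
  ultimately show ?thesis by blast
qed

section \<open>Clusters of close pairs\<close>

lemma dist_nearest_int_le: "dist_nearest_int t \<le> \<bar>t - of_int k\<bar>"
  unfolding dist_nearest_int_def using round_diff_minimal[of t k] by (simp add: abs_minus_commute)

definition close_pairs :: "(nat \<Rightarrow> real) \<Rightarrow> nat \<Rightarrow> real \<Rightarrow> (nat \<times> nat) set" where
  "close_pairs x N s = {(m, n). m \<in> {1..N} \<and> n \<in> {1..N} \<and> m \<noteq> n \<and> real N * \<bar>x m - x n\<bar> \<le> s}"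

lemma finite_close_pairs [simp]: "finite (close_pairs x N s)"
  by (rule finite_subset[of _ "{1..N} \<times> {1..N}"]) (auto simp: close_pairs_def)

text \<open>For \<open>k = 2\<close> the index set \<open>{2..2}\<close> has one element, so the
  rectangle is the interval \<open>{-s..s}\<close> and its volume is \<open>2 * s\<close>; pairs are
  ordered, as are the tuples.\<close>

lemma poissonian_pair_tendsto:
  assumes "poissonian_pair_correlations x" "s \<ge> 0"
  shows "(\<lambda>N. real (card (close_pairs x N s)) / real N) \<longlonglongrightarrow> 2 * s"
proof -
  let ?R = "PiE {2..2::nat} (\<lambda>_. {-s..s})"
  let ?T = "\<lambda>N. {n \<in> distinct_tuples 2 N. (\<lambda>i\<in>{2..2}. real N * (x (n 1) - x (n i))) \<in> ?R}"
  have R: "?R \<in> rectangles 2"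
    unfolding rectangles_def by (auto intro!: exI[of _ "\<lambda>_. {-s..s}"] is_interval_cc)
  interpret product_sigma_finite "\<lambda>_::nat. lborel :: real measure" ..
  have "emeasure (\<Pi>\<^sub>M i\<in>{2..2::nat}. (lborel :: real measure)) ?R = ennreal (2 * s)"
    using \<open>s \<ge> 0\<close> by (subst emeasure_PiM) auto
  then have "measure (\<Pi>\<^sub>M i\<in>{2..2::nat}. (lborel :: real measure)) ?R = 2 * s"
    using \<open>s \<ge> 0\<close> by (simp add: measure_def)
  moreover have "card (?T N) = card (close_pairs x N s)" for N
  proof (rule bij_betw_same_card)
    have I: "{1..2::nat} = {1, 2}" "{Suc 0..2} = {1, 2}" by auto
    have in_R: "(\<lambda>i\<in>{2..2}. real N * (x (n 1) - x (n i))) \<in> ?R \<longleftrightarrow> real N * \<bar>x (n 1) - x (n 2)\<bar> \<le> s"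
      for n :: "nat \<Rightarrow> nat"
      using abs_le_iff[of "real N * (x (n 1) - x (n 2))" s]
      by (auto simp: PiE_iff abs_mult)
    show "bij_betw (\<lambda>n. (n 1, n 2)) (?T N) (close_pairs x N s)"
    proof (rule bij_betw_byWitness[where f' = "\<lambda>(a, b) (i::nat). if i = 1 then a else if i = 2 then b else undefined"])
      show "\<forall>n\<in>?T N. (case (n 1, n 2) of (a, b) \<Rightarrow> \<lambda>i::nat. if i = 1 then a else if i = 2 then b else undefined) = n"
        by (auto simp: distinct_tuples_def I PiE_iff extensional_def fun_eq_iff)
      show "(\<lambda>n. (n 1, n 2)) ` ?T N \<subseteq> close_pairs x N s"
        unfolding in_R by (auto simp: distinct_tuples_def I close_pairs_def)
      show "(\<lambda>(a, b) (i::nat). if i = 1 then a else if i = 2 then b else undefined) ` close_pairs x N s \<subseteq> ?T N"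
      proof
        fix t assume "t \<in> (\<lambda>(a, b) (i::nat). if i = 1 then a else if i = 2 then b else undefined) ` close_pairs x N s"
        then obtain a b where ab: "(a, b) \<in> close_pairs x N s"
          and t: "t = (\<lambda>i::nat. if i = 1 then a else if i = 2 then b else undefined)" by auto
        have "t 1 = a" "t 2 = b" "t \<in> extensional {1, 2}" by (auto simp: t extensional_def)
        then have "t \<in> distinct_tuples 2 N" "real N * \<bar>x (t 1) - x (t 2)\<bar> \<le> s"
          using ab unfolding distinct_tuples_def I(1) by (auto simp: PiE_iff close_pairs_def)
        then show "t \<in> ?T N" unfolding in_R by blast
      qed
    qed auto
  qed
  ultimately show ?thesis
    using assms(1) R unfolding poissonian_correlations_def by auto
qed

text \<open>A fibre of size \<open>c\<close> contains \<open>c\<^sup>2 - c \<ge> 3 * c - 4\<close>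
  ordered pairs, by \<open>(c - 2)\<^sup>2 \<ge> 0\<close>, the tangent at an average fibre size of
  2. Summing gives \<open>3 * card B - 4 * card K\<close>, which is at least
  \<open>card B\<close>.\<close>

lemma card_collisions_ge:
  assumes "finite B" "finite K" "g ` B \<subseteq> K" "2 * card K \<le> card B"
  shows "card B \<le> card {(a, b). a \<in> B \<and> b \<in> B \<and> a \<noteq> b \<and> g a = g b}"
proof -
  define F where "F k = {a \<in> B. g a = k}" for k
  have finF: "finite (F k)" for k using assms by (simp add: F_def)
  have cardB: "card B = (\<Sum>k\<in>K. card (F k))"
    unfolding F_def using sum.group[OF assms(1-3), of "\<lambda>_. 1 :: nat"] by simp
  have "{(a, b). a \<in> B \<and> b \<in> B \<and> a \<noteq> b \<and> g a = g b} = (\<Union>k\<in>K. F k \<times> F k - Id_on (F k))"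
    using assms(3) by (auto simp: F_def)
  then have "card {(a, b). a \<in> B \<and> b \<in> B \<and> a \<noteq> b \<and> g a = g b} = (\<Sum>k\<in>K. card (F k \<times> F k - Id_on (F k)))"
    using assms(2) finF by (simp only:) (rule card_UN_disjoint, auto simp: F_def)
  also have "int \<dots> = (\<Sum>k\<in>K. int (card (F k \<times> F k - Id_on (F k))))" by simp
  also have "\<dots> = (\<Sum>k\<in>K. int (card (F k)) ^ 2 - int (card (F k)))"
  proof (rule sum.cong[OF refl])
    fix k
    have "Id_on (F k) = (\<lambda>a. (a, a)) ` F k" by auto
    then have c: "card (Id_on (F k)) = card (F k)" by (simp add: card_image inj_on_def)
    have "card (F k \<times> F k - Id_on (F k)) = card (F k) * card (F k) - card (F k)"
      using finF[of k] by (subst card_Diff_subset) (auto simp: c card_cartesian_product Id_on_subset_Times intro: finite_subset[OF Id_on_subset_Times])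
    then show "int (card (F k \<times> F k - Id_on (F k))) = int (card (F k)) ^ 2 - int (card (F k))"
      by (simp add: of_nat_diff power2_eq_square)
  qed
  also have "\<dots> \<ge> (\<Sum>k\<in>K. 3 * int (card (F k)) - 4)"
  proof (rule sum_mono)
    fix k
    have "0 \<le> (int (card (F k)) - 2) ^ 2" by simp
    then show "3 * int (card (F k)) - 4 \<le> int (card (F k)) ^ 2 - int (card (F k))"
      by (simp add: power2_eq_square algebra_simps)
  qed
  also have "(\<Sum>k\<in>K. 3 * int (card (F k)) - 4) = 3 * int (card B) - 4 * int (card K)"
    by (simp add: cardB sum_subtractf sum_distrib_left)
  finally show ?thesis using assms(4) by linarith
qed

text \<open>With \<open>n = m + d * j\<close> and \<open>j < J\<close>, the fractional parts differ
  by \<open>j * \<delta>\<close> plus an integer \<open>i\<close>. Lying in the same half of the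
  unit interval, they differ by at most \<open>1 / 2\<close>; since \<open>j * \<delta>\<close> is
  below \<open>1 / 2\<close> in absolute value, \<open>i\<close> must be 0.\<close>

lemma frac_diff_small:
  assumes "m \<le> n" "n < m + d * J" "m mod d = n mod d"
    and "(frac (real m * \<alpha>) < 1 / 2) = (frac (real n * \<alpha>) < 1 / 2)"
    and "real J * dist_nearest_int (real d * \<alpha>) < 1 / 2"
  shows "\<bar>frac (real m * \<alpha>) - frac (real n * \<alpha>)\<bar> \<le> real J * dist_nearest_int (real d * \<alpha>)"
proof -
  obtain j where j: "n = m + d * j"
    using assms(1,3) by (metis dvdE le_add_diff_inverse mod_eq_dvd_iff_nat)
  have "j < J" using assms(2) j by auto
  define e where "e = round (real d * \<alpha>)"
  define \<delta> where "\<delta> = real d * \<alpha> - of_int e"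
  have \<delta>: "\<bar>\<delta>\<bar> = dist_nearest_int (real d * \<alpha>)" by (simp add: \<delta>_def e_def dist_nearest_int_def)
  define i where "i = int j * e - \<lfloor>real n * \<alpha>\<rfloor> + \<lfloor>real m * \<alpha>\<rfloor>"
  have eq: "frac (real n * \<alpha>) - frac (real m * \<alpha>) = real j * \<delta> + of_int i"
    by (simp add: frac_def i_def \<delta>_def j algebra_simps)
  have le: "\<bar>real j * \<delta>\<bar> \<le> real J * dist_nearest_int (real d * \<alpha>)"
    using \<open>j < J\<close> by (simp add: abs_mult \<delta>[symmetric] mult_right_mono)
  have "\<bar>frac (real n * \<alpha>) - frac (real m * \<alpha>)\<bar> \<le> 1 / 2"
    using assms(4) frac_ge_0[of "real n * \<alpha>"] frac_ge_0[of "real m * \<alpha>"]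
      frac_lt_1[of "real n * \<alpha>"] frac_lt_1[of "real m * \<alpha>"]
    by (smt (verit) field_sum_of_halves)
  then have "\<bar>real_of_int i\<bar> < 1" using eq le assms(5) by linarith
  then have "i = 0" by linarith
  then show ?thesis using eq le by (simp add: abs_minus_commute)
qed

text \<open>Pigeonhole: the key of a point records its residue modulo \<open>d\<close>, its interval of length
  \<open>d * J\<close>, and the half of the unit interval containing its fractional part. The last component
  turns closeness modulo 1 into closeness of real numbers.\<close>

lemma card_close_pairs_ge:
  fixes \<alpha> :: real and a :: "nat \<Rightarrow> nat"
  assumes bij: "bij_betw a {1..N} B" and B: "B \<subseteq> {1..M}"
    and d: "d \<ge> 1" "16 * d \<le> N"
    and small: "128 * (real M * dist_nearest_int (real d * \<alpha>)) \<le> 1"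
  shows "N \<le> card (close_pairs (\<lambda>n. frac (real (a n) * \<alpha>)) N (1 / 8))"
proof -
  have finB: "finite B" using B finite_subset by blast
  have N: "N = card B" using bij_betw_same_card[OF bij] by simp
  have N0: "N > 0" using d by simp
  have NM: "N \<le> M" using card_mono[OF _ B] by (simp add: N)
  \<comment> \<open>This gives \<open>8 * M \<le> J * N \<le> 16 * M\<close>. The lower bound, with
    \<open>16 * d \<le> N\<close>, limits the number of keys to \<open>N / 4 + N / 8\<close>, less
    than half of \<open>N\<close>; the upper bound and the factor 128 bound the gap by
    \<open>1 / (8 * N)\<close>.\<close>
  define J where "J = 8 * M div N + 1"
  have J1: "real J * real N \<ge> 8 * real M"
  proof -
    have "8 * M < (8 * M div N + 1) * N" using N0
      by (metis Suc_eq_plus1 dividend_less_div_times mult_Suc add.commute)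
    then have "8 * M \<le> J * N" by (simp add: J_def)
    then show ?thesis by (metis of_nat_le_iff of_nat_mult of_nat_numeral)
  qed
  have J2: "real J * real N \<le> 16 * real M"
  proof -
    have "8 * M div N * N \<le> 8 * M" by (rule div_times_less_eq_dividend)
    then have "J * N \<le> 16 * M" using NM unfolding J_def add_mult_distrib by linarith
    then show ?thesis by (metis of_nat_le_iff of_nat_mult of_nat_numeral)
  qed
  define \<epsilon> where "\<epsilon> = dist_nearest_int (real d * \<alpha>)"
  have eps0: "\<epsilon> \<ge> 0" by (simp add: \<epsilon>_def dist_nearest_int_def)
  have NJ: "real N * (real J * \<epsilon>) \<le> 1 / 8"
  proof -
    have "(real J * real N) * \<epsilon> \<le> (16 * real M) * \<epsilon>" using J2 eps0 by (rule mult_right_mono)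
    moreover have "128 * (real M * \<epsilon>) \<le> 1" using small by (simp add: \<epsilon>_def)
    moreover have "real N * (real J * \<epsilon>) = (real J * real N) * \<epsilon>" by simp
    ultimately show ?thesis by linarith
  qed
  have Jeps: "real J * \<epsilon> < 1 / 2"
  proof -
    have "1 * (real J * \<epsilon>) \<le> real N * (real J * \<epsilon>)" using N0 eps0 by (intro mult_right_mono) auto
    then show ?thesis using NJ by linarith
  qed
  define g where "g n = (n mod d, n div (d * J), frac (real n * \<alpha>) < 1 / 2)" for n :: nat
  let ?K = "{..<d} \<times> {..M div (d * J)} \<times> (UNIV :: bool set)"
  have "g ` B \<subseteq> ?K" using B d by (auto simp: g_def intro!: div_le_mono)
  moreover have "2 * card ?K \<le> card B"
  proof -
    have "real (d * (M div (d * J))) \<le> real N / 8"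
    proof -
      have "d * (M div (d * J)) \<le> M div J"
        by (metis div_mult2_eq mult.commute times_div_less_eq_dividend)
      then have "real (d * (M div (d * J))) \<le> real (M div J)" by (rule of_nat_mono)
      also have "\<dots> \<le> real M / real J" by (rule real_div_le)
      also have "\<dots> \<le> real N / 8" using J1 by (simp add: J_def field_simps)
      finally show ?thesis .
    qed
    moreover have "card ?K = 2 * (d * (M div (d * J))) + 2 * d"
      by (simp add: card_cartesian_product algebra_simps)
    ultimately have "real (2 * card ?K) \<le> real N" using d(2) by simp
    then show ?thesis by (simp only: N of_nat_le_iff)
  qed
  ultimately have "N \<le> card {(m, n). m \<in> B \<and> n \<in> B \<and> m \<noteq> n \<and> g m = g n}"
    unfolding N using finB by (intro card_collisions_ge[of B ?K g]) auto
  also have "\<dots> \<le> card (map_prod a a ` close_pairs (\<lambda>n. frac (real (a n) * \<alpha>)) N (1 / 8))"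
  proof (rule card_mono)
    have close: "real N * \<bar>frac (real m * \<alpha>) - frac (real n * \<alpha>)\<bar> \<le> 1 / 8"
      if "g m = g n" "m \<le> n" for m n
    proof -
      have "n < m + d * J"
      proof -
        have dJ: "d * J > 0" using d by (simp add: J_def)
        have "n div (d * J) = m div (d * J)" using that by (simp add: g_def)
        then have "n < d * J + d * J * (m div (d * J))"
          using dividend_less_times_div[OF dJ, of n] by simp
        then show ?thesis using times_div_less_eq_dividend[of "d * J" m] by linarith
      qed
      then have "\<bar>frac (real m * \<alpha>) - frac (real n * \<alpha>)\<bar> \<le> real J * \<epsilon>"
        unfolding \<epsilon>_def using that Jeps
        by (intro frac_diff_small) (auto simp: g_def \<epsilon>_def)
      then have "real N * \<bar>frac (real m * \<alpha>) - frac (real n * \<alpha>)\<bar> \<le> real N * (real J * \<epsilon>)"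
        by (intro mult_left_mono) auto
      then show ?thesis using NJ by linarith
    qed
    show "{(m, n). m \<in> B \<and> n \<in> B \<and> m \<noteq> n \<and> g m = g n}
        \<subseteq> map_prod a a ` close_pairs (\<lambda>n. frac (real (a n) * \<alpha>)) N (1 / 8)"
    proof safe
      fix m n assume mn: "m \<in> B" "n \<in> B" "m \<noteq> n" "g m = g n"
      obtain k l where kl: "k \<in> {1..N}" "l \<in> {1..N}" "a k = m" "a l = n"
        using mn bij by (metis bij_betw_imp_surj_on imageE)
      have "real N * \<bar>frac (real m * \<alpha>) - frac (real n * \<alpha>)\<bar> \<le> 1 / 8"
        using close[of m n] close[of n m] mn by (cases "m \<le> n") (auto simp: abs_minus_commute)
      then have "(k, l) \<in> close_pairs (\<lambda>n. frac (real (a n) * \<alpha>)) N (1 / 8)"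
        using kl mn by (auto simp: close_pairs_def)
      then show "(m, n) \<in> map_prod a a ` close_pairs (\<lambda>n. frac (real (a n) * \<alpha>)) N (1 / 8)"
        using kl by force
    qed
  qed auto
  also have "\<dots> \<le> card (close_pairs (\<lambda>n. frac (real (a n) * \<alpha>)) N (1 / 8))"
    by (rule card_image_le) simp
  finally show ?thesis .
qed

section \<open>From clusters to the failure of Poissonian pair correlations\<close>

lemma bij_betw_enumerate_upto:
  fixes A :: "nat set"
  assumes "infinite A"
  shows "bij_betw (\<lambda>n. enumerate A (n - 1)) {1..card {x \<in> A. x \<le> M}} {x \<in> A. x \<le> M}"
proof -
  define c where "c = (LEAST k. M < enumerate A k)"
  have "M < enumerate A (Suc M)" using le_enumerate[OF assms, of "Suc M"] by simp
  then have c: "M < enumerate A c" unfolding c_def by (rule LeastI)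
  have lt: "enumerate A k \<le> M \<longleftrightarrow> k < c" for k
  proof
    show "enumerate A k \<le> M" if "k < c" using not_less_Least[of k "\<lambda>k. M < enumerate A k"] that by (simp add: c_def)
    show "k < c" if "enumerate A k \<le> M"
    proof (rule ccontr)
      assume "\<not> k < c"
      then have "enumerate A c \<le> enumerate A k" using assms by simp
      then show False using c that by simp
    qed
  qed
  have bij: "bij_betw (enumerate A) {..<c} {x \<in> A. x \<le> M}"
    unfolding bij_betw_def
  proof
    show "inj_on (enumerate A) {..<c}" using assms inj_enumerate inj_on_subset by blast
    show "enumerate A ` {..<c} = {x \<in> A. x \<le> M}"
    proof (intro equalityI subsetI)
      fix x assume "x \<in> {x \<in> A. x \<le> M}"
      then obtain k where "enumerate A k = x" "enumerate A k \<le> M" using enumerate_Ex[of A x] assms by blast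
      then show "x \<in> enumerate A ` {..<c}" using lt by blast
    qed (use lt enumerate_in_set[OF assms] in blast)
  qed
  have "card {x \<in> A. x \<le> M} = card {..<c}" by (rule bij_betw_same_card[OF bij, symmetric])
  then have "card {x \<in> A. x \<le> M} = c" by (simp only: card_lessThan)
  moreover have "bij_betw (\<lambda>n. n - 1) {1..c} {..<c}"
    by (rule bij_betw_byWitness[where f' = Suc]) auto
  ultimately show ?thesis using bij_betw_trans[OF _ bij] by (simp add: o_def)
qed

text \<open>At scale \<open>1 / 8\<close> the Poissonian limit is \<open>1 / 4\<close>, while the
  cluster bound makes the ratio at least 1 whenever \<open>N\<close> is the count up to a suitable
  \<open>M\<close>. The parameter \<open>N0\<close> lets such \<open>N\<close> be arbitrarily
  large.\<close>

lemma not_poissonian_criterion: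
  fixes A :: "nat set"
  assumes "infinite A" "0 \<notin> A"
    and ex: "\<And>N0. \<exists>M d. d \<ge> 1 \<and> N0 \<le> card {x \<in> A. x \<le> M} \<and> 16 * d \<le> card {x \<in> A. x \<le> M} \<and>
            128 * (real M * dist_nearest_int (real d * \<alpha>)) \<le> 1"
  shows "\<not> poissonian_pair_correlations (\<lambda>n. frac (real (enumerate A (n - 1)) * \<alpha>))"
proof
  let ?x = "\<lambda>n. frac (real (enumerate A (n - 1)) * \<alpha>)"
  assume "poissonian_pair_correlations ?x"
  then have "(\<lambda>N. real (card (close_pairs ?x N (1 / 8))) / real N) \<longlonglongrightarrow> 2 * (1 / 8)"
    by (rule poissonian_pair_tendsto) simp
  then have "\<forall>\<^sub>F N in sequentially. real (card (close_pairs ?x N (1 / 8))) / real N < 1"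
    by (rule order_tendstoD) simp
  then obtain N0 where N0: "\<And>N. N \<ge> N0 \<Longrightarrow> real (card (close_pairs ?x N (1 / 8))) / real N < 1"
    by (auto simp: eventually_sequentially)
  obtain M d where Md: "d \<ge> 1" "N0 \<le> card {x \<in> A. x \<le> M}" "16 * d \<le> card {x \<in> A. x \<le> M}"
    "128 * (real M * dist_nearest_int (real d * \<alpha>)) \<le> 1"
    using ex by blast
  let ?N = "card {x \<in> A. x \<le> M}"
  have sub: "{x \<in> A. x \<le> M} \<subseteq> {1..M}"
    using assms(2) by (auto simp: Suc_le_eq intro: gr0I)
  have "?N \<le> card (close_pairs ?x ?N (1 / 8))"
    using card_close_pairs_ge[OF bij_betw_enumerate_upto[OF assms(1)] sub Md(1,3,4)] by simp
  moreover have "?N > 0" using Md by linarith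
  ultimately have "1 \<le> real (card (close_pairs ?x ?N (1 / 8))) / real ?N" by simp
  then show False using N0[OF Md(2)] by linarith
qed

section \<open>The divergence case of Khinchin's theorem\<close>

text \<open>The Farey fractions of order \<open>Q\<close>. They form a set of real values, so
  unreduced representations do no harm.\<close>

definition farey :: "nat \<Rightarrow> real set" where
  "farey Q = (\<lambda>(q, a). real a / real q) ` (SIGMA q:{1..Q}. {..q})"

lemma finite_farey [simp]: "finite (farey Q)"
  by (simp add: farey_def)

lemma card_farey_le: "card (farey Q) \<le> 2 * Q\<^sup>2"
proof -
  have "card (farey Q) \<le> card (SIGMA q:{1..Q}. {..q})"
    unfolding farey_def by (rule card_image_le) auto
  also have "\<dots> = (\<Sum>q=1..Q. q + 1)" by simp
  also have "\<dots> \<le> (\<Sum>q=1..Q. 2 * Q)" by (rule sum_mono) auto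
  finally show ?thesis by (simp add: power2_eq_square)
qed

lemma farey_in_unit: "p \<in> farey Q \<Longrightarrow> p \<in> {0..1}"
  by (auto simp: farey_def)

text \<open>The numerator of the difference over the common denominator \<open>q * q'\<close> is a
  nonzero integer.\<close>

lemma farey_spacing:
  assumes "p \<in> farey Q" "p' \<in> farey Q" "p \<noteq> p'"
  shows "1 / (real Q)\<^sup>2 \<le> \<bar>p - p'\<bar>"
proof -
  obtain q a q' a' where q: "1 \<le> q" "q \<le> Q" "p = real a / real q" and q': "1 \<le> q'" "q' \<le> Q" "p' = real a' / real q'"
    using assms by (auto simp: farey_def)
  have eq: "p - p' = of_int (int a * int q' - int a' * int q) / (real q * real q')"
    using q q' by (simp add: diff_frac_eq mult.commute)
  have "int a * int q' - int a' * int q \<noteq> 0"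
    using eq assms(3) by (metis div_0 eq_iff_diff_eq_0 of_int_0)
  then have "1 \<le> \<bar>int a * int q' - int a' * int q\<bar>" by linarith
  then have "1 \<le> \<bar>of_int (int a * int q' - int a' * int q) :: real\<bar>"
    by (simp only: of_int_abs[symmetric] of_int_1_le_iff)
  then have "1 / (real q * real q') \<le> \<bar>p - p'\<bar>"
    using q q' unfolding eq abs_divide by (simp add: divide_right_mono)
  moreover have "1 / (real Q)\<^sup>2 \<le> 1 / (real q * real q')"
    using q q' by (intro divide_left_mono) (auto simp: power2_eq_square mult_mono)
  ultimately show ?thesis by linarith
qed

lemma farey_approx:
  assumes "\<alpha> \<in> {0..1}" "Q \<ge> 2"
  obtains a q where "q \<in> {1..Q}" "a \<le> q" "\<bar>\<alpha> - real a / real q\<bar> < 1 / (real q * real Q)"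
proof -
  obtain h k where hk: "0 < k" "k \<le> int Q" "\<bar>of_int k * \<alpha> - of_int h\<bar> < 1 / real Q"
    using Dirichlet_approx[of Q \<alpha> thesis] Dirichlet_approx[of Q \<alpha>] assms(2) by (metis gr0I not_numeral_le_zero)
  \<comment> \<open>This is where \<open>Q \<ge> 2\<close> enters: an error below 1 forces the
    numerator into \<open>{0..k}\<close>, so the approximation is itself a Farey fraction.\<close>
  have "1 / real Q < 1" using assms(2) by simp
  moreover have "0 \<le> of_int k * \<alpha>" "of_int k * \<alpha> \<le> of_int k"
    using hk(1) assms(1) by (auto simp: mult_left_le)
  ultimately have "- 1 < (of_int h :: real)" "(of_int h :: real) < of_int k + 1" using hk(3) by linarith+
  then have h: "0 \<le> h" "h \<le> k" by linarith+
  have k: "real (nat k) = of_int k" "real (nat h) = of_int h" using hk(1) h by auto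
  have "\<alpha> - real (nat h) / real (nat k) = (of_int k * \<alpha> - of_int h) / of_int k"
    using hk(1) by (simp add: k field_simps)
  then have "\<bar>\<alpha> - real (nat h) / real (nat k)\<bar> = \<bar>of_int k * \<alpha> - of_int h\<bar> / of_int k"
    using hk(1) by simp
  also have "\<dots> < (1 / real Q) / of_int k" using hk by (intro divide_strict_right_mono) auto
  also have "\<dots> = 1 / (real (nat k) * real Q)" by (simp add: k)
  finally show ?thesis 
    using that[of "nat k" "nat h"] hk(1,2) h by (auto simp: nat_le_iff)
qed

lemma emeasure_cball_real: "r \<ge> 0 \<Longrightarrow> emeasure lborel (cball (x::real) r) = ennreal (2 * r)"
  by (simp add: cball_eq_atLeastAtMost)

lemma emeasure_ball_real: "r \<ge> 0 \<Longrightarrow> emeasure lborel (ball (x::real) r) = ennreal (2 * r)"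
  by (simp add: ball_eq_greaterThanLessThan)

lemma emeasure_annulus_le:
  fixes x :: real
  assumes "r \<ge> 0" "w \<ge> 0"
  shows "emeasure lborel (cball x (r + w) - ball x r) \<le> ennreal (2 * w)"
proof -
  have "emeasure lborel (cball x (r + w) - ball x r) = ennreal (2 * (r + w)) - ennreal (2 * r)"
    using assms by (subst emeasure_Diff) (auto simp: emeasure_cball_real emeasure_ball_real)
  also have "\<dots> = ennreal (2 * w)"
    using assms by (subst ennreal_minus) (auto simp: algebra_simps)
  finally show ?thesis by simp
qed

text \<open>A point \<open>\<alpha>\<close> outside \<open>W\<close> has a Dirichlet approximation \<open>a / q\<close> with \<open>q \<le> Q\<close>. Either \<open>q\<close> is
  small, or \<open>a / q\<close> is near \<open>W\<close>, so that \<open>\<alpha>\<close> lies in a thin annulus, or \<open>a / q\<close> is counted.\<close>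

lemma card_farey_avoiding_ge:
  fixes x r :: "'i \<Rightarrow> real"
  assumes I: "finite I" "\<And>i. i \<in> I \<Longrightarrow> r i \<ge> 0" and Q: "Q \<ge> 2" and \<eta>: "\<eta> > 0"
    and W: "W = (\<Union>i\<in>I. ball (x i) (r i))"
    and P: "P = {p \<in> farey Q. ball p (1 / (real Q)\<^sup>2) \<inter> W = {}}"
  shows "emeasure lborel ({0..1} - W) \<le> ennreal (4 * \<eta>
     + real (card I) * (2 * ((1 + 1 / \<eta>) / (real Q)\<^sup>2)) + real (card P) * (2 / (\<eta> * (real Q)\<^sup>2)))"
proof -
  have Q0: "real Q > 0" using Q by simp
  \<comment> \<open>The width is the sum of \<open>1 / Q\<^sup>2\<close>, the distance within which
    \<open>a / q\<close> comes to \<open>W\<close>, and \<open>1 / (\<eta> * Q\<^sup>2)\<close>, the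
    distance from \<open>\<alpha>\<close> to \<open>a / q\<close> when
    \<open>q > \<eta> * Q\<close>.\<close>
  define w where "w = (1 + 1 / \<eta>) / (real Q)\<^sup>2"
  have w0: "w \<ge> 0" using \<eta> by (simp add: w_def)
  have finP: "finite P" by (simp add: P)
  define S1 where "S1 = (\<Union>q\<in>{1..nat \<lfloor>\<eta> * real Q\<rfloor>}. \<Union>a\<in>{..q}. cball (real a / real q) (1 / (real q * real Q)))"
  define S2 where "S2 = (\<Union>i\<in>I. cball (x i) (r i + w) - ball (x i) (r i))"
  define S3 where "S3 = (\<Union>p\<in>P. cball p (1 / (\<eta> * (real Q)\<^sup>2)))"
  have sub: "{0..1} - W \<subseteq> S1 \<union> (S2 \<union> S3)"
  proof
    fix \<alpha> assume \<alpha>: "\<alpha> \<in> {0..1} - W"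
    obtain q a where qa: "q \<in> {1..Q}" "a \<le> q" "\<bar>\<alpha> - real a / real q\<bar> < 1 / (real q * real Q)"
      using farey_approx[of \<alpha> Q] \<alpha> Q by blast
    define p where "p = real a / real q"
    have pF: "p \<in> farey Q" using qa by (force simp: farey_def p_def)
    show "\<alpha> \<in> S1 \<union> (S2 \<union> S3)"
    proof (cases "real q \<le> \<eta> * real Q")
      case True
      then have "q \<in> {1..nat \<lfloor>\<eta> * real Q\<rfloor>}" using qa by (auto simp: le_nat_floor)
      moreover have "\<alpha> \<in> cball (real a / real q) (1 / (real q * real Q))"
        using qa(3) by (simp add: dist_real_def abs_minus_commute)
      ultimately show ?thesis using qa(2) unfolding S1_def by blast
    next
      case False
      have "1 / (real q * real Q) \<le> 1 / (\<eta> * (real Q)\<^sup>2)"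
      proof (rule divide_left_mono)
        show "\<eta> * (real Q)\<^sup>2 \<le> real q * real Q"
          using False Q0 by (simp add: power2_eq_square)
      qed (use \<eta> Q0 qa in auto)
      then have close: "\<bar>\<alpha> - p\<bar> < 1 / (\<eta> * (real Q)\<^sup>2)" using qa(3) by (simp add: p_def)
      show ?thesis
      proof (cases "p \<in> P")
        case True
        then show ?thesis using close unfolding S3_def by (force simp: dist_real_def)
      next
        case False
        then obtain y i where y: "i \<in> I" "\<bar>p - y\<bar> < 1 / (real Q)\<^sup>2" "\<bar>x i - y\<bar> < r i"
          using pF unfolding P W by (auto simp: dist_real_def)
        have "1 / (real Q)\<^sup>2 + 1 / (\<eta> * (real Q)\<^sup>2) = w" by (simp add: w_def add_divide_distrib)
        then have "\<bar>x i - \<alpha>\<bar> \<le> r i + w" using close y by linarith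
        moreover have "\<alpha> \<notin> ball (x i) (r i)" using \<alpha> y(1) by (auto simp: W)
        ultimately show ?thesis using y(1) unfolding S2_def by (auto simp: dist_real_def)
      qed
    qed
  qed
  \<comment> \<open>Small denominators: each \<open>q\<close> has \<open>q + 1\<close> numerators
    and intervals of length \<open>2 / (q * Q)\<close>, at most \<open>4 / Q\<close> in total, and
    there are at most \<open>\<eta> * Q\<close> such \<open>q\<close>.\<close>
  have "emeasure lborel S1 \<le> (\<Sum>q\<in>{1..nat \<lfloor>\<eta> * real Q\<rfloor>}. ennreal (4 / real Q))"
    unfolding S1_def
  proof (rule order.trans[OF emeasure_subadditive_finite sum_mono])
    fix q assume "q \<in> {1..nat \<lfloor>\<eta> * real Q\<rfloor>}"
    then have q: "q \<ge> 1" by simp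
    have "emeasure lborel (\<Union>a\<in>{..q}. cball (real a / real q) (1 / (real q * real Q)))
        \<le> (\<Sum>a\<in>{..q}. ennreal (2 * (1 / (real q * real Q))))"
      using q by (intro order.trans[OF emeasure_subadditive_finite sum_mono])
                 (auto simp: emeasure_cball_real)
    also have "\<dots> = ennreal (real (q + 1) * (2 * (1 / (real q * real Q))))"
      by (subst sum_ennreal) auto
    also have "\<dots> \<le> ennreal (4 / real Q)"
      using q Q0 by (intro ennreal_leI) (simp add: field_simps)
    finally show "emeasure lborel (\<Union>a\<in>{..q}. cball (real a / real q) (1 / (real q * real Q))) \<le> ennreal (4 / real Q)" .
  qed auto
  also have "\<dots> = ennreal (real (nat \<lfloor>\<eta> * real Q\<rfloor>) * (4 / real Q))"
    by (subst sum_ennreal) auto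
  also have "\<dots> \<le> ennreal (4 * \<eta>)"
  proof (rule ennreal_leI)
    have "real (nat \<lfloor>\<eta> * real Q\<rfloor>) \<le> \<eta> * real Q" using \<eta> Q0 by (intro of_nat_floor) simp
    then have "real (nat \<lfloor>\<eta> * real Q\<rfloor>) * (4 / real Q) \<le> \<eta> * real Q * (4 / real Q)" by (rule mult_right_mono) simp
    then show "real (nat \<lfloor>\<eta> * real Q\<rfloor>) * (4 / real Q) \<le> 4 * \<eta>" using Q0 by simp
  qed
  finally have 1: "emeasure lborel S1 \<le> ennreal (4 * \<eta>)" .
  have "emeasure lborel S2 \<le> (\<Sum>i\<in>I. ennreal (2 * w))"
    unfolding S2_def using I w0
    by (intro order.trans[OF emeasure_subadditive_finite sum_mono] emeasure_annulus_le) auto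
  also have "\<dots> = ennreal (real (card I) * (2 * w))"
    using w0 by (subst sum_ennreal) auto
  finally have 2: "emeasure lborel S2 \<le> ennreal (real (card I) * (2 * w))" .
  have "emeasure lborel S3 \<le> (\<Sum>p\<in>P. ennreal (2 / (\<eta> * (real Q)\<^sup>2)))"
    unfolding S3_def using finP \<eta>
    by (intro order.trans[OF emeasure_subadditive_finite sum_mono]) (auto simp: emeasure_cball_real)
  also have "\<dots> = ennreal (real (card P) * (2 / (\<eta> * (real Q)\<^sup>2)))"
    using \<eta> by (subst sum_ennreal) auto
  finally have 3: "emeasure lborel S3 \<le> ennreal (real (card P) * (2 / (\<eta> * (real Q)\<^sup>2)))" .
  have meas: "S1 \<in> sets lborel" "S2 \<in> sets lborel" "S3 \<in> sets lborel"
    unfolding S1_def S2_def S3_def using I finP by (auto intro!: sets.finite_UN)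
  have "emeasure lborel ({0..1} - W) \<le> emeasure lborel (S1 \<union> (S2 \<union> S3))"
    using sub meas by (intro emeasure_mono) auto
  also have "\<dots> \<le> emeasure lborel S1 + (emeasure lborel S2 + emeasure lborel S3)"
    using meas by (intro order.trans[OF emeasure_subadditive] add_left_mono emeasure_subadditive) auto
  also have "\<dots> \<le> ennreal (4 * \<eta>) + (ennreal (real (card I) * (2 * w)) + ennreal (real (card P) * (2 / (\<eta> * (real Q)\<^sup>2))))"
    by (intro add_mono 1 2 3)
  also have "\<dots> = ennreal (4 * \<eta> + real (card I) * (2 * w) + real (card P) * (2 / (\<eta> * (real Q)\<^sup>2)))"
    using \<eta> w0 by (simp add: add.assoc flip: ennreal_plus)
  finally show ?thesis by (simp add: w_def)
qed

text \<open>The balls around points of \<open>P\<close> are disjoint from \<open>W\<close> by the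
  choice of \<open>P\<close>, and from one another because Farey fractions are at least
  \<open>1 / Q\<^sup>2 \<ge> 2 * \<rho>\<close> apart. Their lengths therefore add to the measure of
  \<open>W\<close> in full.\<close>

lemma measure_Un_farey_balls_ge:
  assumes W: "open W" "emeasure lborel W < \<infinity>" and Q: "Q \<ge> 1" and \<rho>: "0 \<le> \<rho>" "2 * \<rho> \<le> 1 / (real Q)\<^sup>2"
    and P: "P = {p \<in> farey Q. ball p (1 / (real Q)\<^sup>2) \<inter> W = {}}"
  shows "measure lborel W + real (card P) * (2 * \<rho>) \<le> measure lborel (W \<union> (\<Union>p\<in>farey Q. ball p \<rho>))"
proof -
  have finP: "finite P" by (simp add: P)
  have fm: "W \<in> fmeasurable lborel" using W by (auto simp: fmeasurable_def)
  have fb: "ball p \<rho> \<in> fmeasurable lborel" for p :: real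
    using \<rho> by (auto simp: fmeasurable_def emeasure_ball_real)
  have fU: "(\<Union>p\<in>S. ball p \<rho>) \<in> fmeasurable lborel" if "finite S" for S :: "real set"
    using that fb by (intro fmeasurable.finite_UN) auto
  have disj: "disjoint_family_on (\<lambda>p. ball p \<rho>) P"
    unfolding disjoint_family_on_def
  proof safe
    fix p p' y assume *: "p \<in> P" "p' \<in> P" "p \<noteq> p'" "y \<in> ball p \<rho>" "y \<in> ball p' \<rho>"
    have "\<bar>p - p'\<bar> \<ge> 1 / (real Q)\<^sup>2" using * by (intro farey_spacing) (auto simp: P)
    then have False using * \<rho> by (auto simp: dist_real_def)
    then show "y \<in> {}" by simp
  qed
  have "measure lborel (\<Union>p\<in>P. ball p \<rho>) = (\<Sum>p\<in>P. measure lborel (ball p \<rho>))"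
    using finP disj fb by (intro measure_finite_Union) (auto simp: fmeasurable_def less_top)
  also have "\<dots> = real (card P) * (2 * \<rho>)"
    using \<rho> by (simp add: measure_def emeasure_ball_real)
  finally have "measure lborel W + real (card P) * (2 * \<rho>) = measure lborel W + measure lborel (\<Union>p\<in>P. ball p \<rho>)" by simp
  also have "\<dots> = measure lborel (W \<union> (\<Union>p\<in>P. ball p \<rho>))"
  proof (rule measure_Un_AE[symmetric])
    have "W \<inter> (\<Union>p\<in>P. ball p \<rho>) = {}"
    proof -
      have "ball p \<rho> \<subseteq> ball p (1 / (real Q)\<^sup>2)" for p :: real using \<rho> by (intro subset_ball) simp
      then show ?thesis by (fastforce simp: P)
    qed
    then show "AE x in lborel. x \<notin> W \<or> x \<notin> (\<Union>p\<in>P. ball p \<rho>)" by (intro AE_I2) blast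
  qed (use fm fU[OF finP] in auto)
  also have "\<dots> \<le> measure lborel (W \<union> (\<Union>p\<in>farey Q. ball p \<rho>))"
  proof (rule measure_mono_fmeasurable)
    show "W \<union> (\<Union>p\<in>P. ball p \<rho>) \<subseteq> W \<union> (\<Union>p\<in>farey Q. ball p \<rho>)" by (auto simp: P)
    show "W \<union> (\<Union>p\<in>P. ball p \<rho>) \<in> sets lborel" using W(1) by (simp add: borel_open open_UN open_Un)
    show "W \<union> (\<Union>p\<in>farey Q. ball p \<rho>) \<in> fmeasurable lborel" using fm fU by auto
  qed
  finally show ?thesis .
qed

text \<open>At level \<open>k\<close> there are of order \<open>b ^ (2 * k)\<close> balls, of total
  length of order \<open>1 / k\<close>, and the harmonic series diverges. The factor
  \<open>k\<close> stands for \<open>ln q\<close>, since \<open>q \<le> b ^ k\<close> means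
  \<open>ln q \<le> k * ln b\<close>.\<close>

definition farey_balls :: "nat \<Rightarrow> nat \<Rightarrow> real set" where
  "farey_balls b k = (\<Union>p\<in>farey (b ^ k). ball p (1 / ((real (b ^ k))\<^sup>2 * real k)))"

lemma open_farey_balls: "open (farey_balls b k)"
  unfolding farey_balls_def by (intro open_UN ballI open_ball)

lemma farey_balls_bounded:
  assumes "b \<ge> 1" "k \<ge> 1"
  shows "farey_balls b k \<subseteq> {-1..2}"
proof
  fix y assume "y \<in> farey_balls b k"
  then obtain p where p: "p \<in> farey (b ^ k)" "\<bar>p - y\<bar> < 1 / ((real (b ^ k))\<^sup>2 * real k)"
    by (auto simp: farey_balls_def dist_real_def)
  have "1 * 1 \<le> (real (b ^ k))\<^sup>2 * real k"
    using assms by (intro mult_mono) (auto simp: one_le_power)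
  then have "1 / ((real (b ^ k))\<^sup>2 * real k) \<le> 1" by simp
  then show "y \<in> {-1..2}" using p farey_in_unit[OF p(1)] by auto
qed

text \<open>If the uncovered set kept measure above \<open>\<epsilon>\<close>, level \<open>n + 1\<close> would add at least
  \<open>\<epsilon>\<^sup>2 / (32 (n + 1))\<close> to the covered measure, which is at most 3. A large base \<open>b\<close> makes the annuli
  around the balls of earlier levels negligible.\<close>

lemma farey_balls_cover:
  assumes \<epsilon>: "\<epsilon> > 0"
  shows "\<exists>b\<ge>2. \<forall>k0\<ge>1. emeasure lborel ({0..1} - (\<Union>k\<in>{k0..}. farey_balls b k)) \<le> ennreal \<epsilon>"
proof -
  \<comment> \<open>Small denominators then cost \<open>4 * \<eta> = \<epsilon> / 4\<close>. The
    choice of \<open>b\<close> below bounds the annuli by another \<open>\<epsilon> / 4\<close>: up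
    to level \<open>n\<close> there are at most \<open>8 * b ^ (2 * n)\<close> balls, and the width
    carries the factor \<open>1 / b ^ (2 * n + 2)\<close>. So the fractions in \<open>P\<close> must
    account for \<open>\<epsilon> / 2\<close>.\<close>
  define \<eta> where "\<eta> = \<epsilon> / 16"
  have \<eta>: "\<eta> > 0" using \<epsilon> by (simp add: \<eta>_def)
  obtain b0 :: nat where b0: "real b0 \<ge> 64 * (1 + 1 / \<eta>) / \<epsilon>" using real_arch_simple by blast
  define b where "b = max b0 2"
  have b2: "b \<ge> 2" by (simp add: b_def)
  have b_large: "16 * (1 + 1 / \<eta>) / (real b)\<^sup>2 \<le> \<epsilon> / 4"
  proof -
    have "64 * (1 + 1 / \<eta>) / \<epsilon> \<le> real b" using b0 by (simp add: b_def)
    also have "\<dots> \<le> (real b)\<^sup>2" using b2 by (simp add: power2_eq_square)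
    finally show ?thesis using \<epsilon> b2 by (simp add: field_simps)
  qed
  have "emeasure lborel ({0..1} - (\<Union>k\<in>{k0..}. farey_balls b k)) \<le> ennreal \<epsilon>" if k0: "k0 \<ge> 1" for k0
  proof (rule ccontr)
    assume contra: "\<not> ?thesis"
    define W where "W n = (\<Union>k\<in>{k0..n}. farey_balls b k)" for n
    have openW: "open (W n)" for n unfolding W_def by (auto intro: open_farey_balls)
    have W_bd: "W n \<subseteq> {-1..2}" for n
      unfolding W_def using farey_balls_bounded b2 k0 by (intro UN_least) auto
    have W_fin: "emeasure lborel (W n) < \<infinity>" for n
    proof -
      have "emeasure lborel (W n) \<le> emeasure lborel {-1..2::real}"
        using W_bd by (intro emeasure_mono) auto
      then show ?thesis by (simp add: le_less_trans)
    qed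
    have W3: "measure lborel (W n) \<le> 3" for n
    proof -
      have "measure lborel (W n) \<le> measure lborel {-1..2::real}"
        using W_bd openW by (intro measure_mono_fmeasurable) (auto simp: fmeasurable_def)
      then show ?thesis by simp
    qed
    have increment: "measure lborel (W n) + \<epsilon>\<^sup>2 / 32 / real (Suc n) \<le> measure lborel (W (Suc n))" if n: "n \<ge> k0" for n
    proof -
      define Q where "Q = b ^ Suc n"
      have Q2: "Q \<ge> 2" using b2 self_le_power[of b "Suc n"] by (simp add: Q_def del: power_Suc)
      define I where "I = (SIGMA k:{k0..n}. farey (b ^ k))"
      define r where "r = (\<lambda>(k, p::real). 1 / ((real (b ^ k))\<^sup>2 * real k))"
      define P where "P = {p \<in> farey Q. ball p (1 / (real Q)\<^sup>2) \<inter> W n = {}}"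
      have W_eq: "W n = (\<Union>i\<in>I. ball (snd i) (r i))"
        unfolding W_def I_def r_def farey_balls_def by force
      have cardI: "real (card I) \<le> 8 * (real (b ^ n))\<^sup>2"
      proof -
        have "card I = (\<Sum>k\<in>{k0..n}. card (farey (b ^ k)))" unfolding I_def by simp
        also have "\<dots> \<le> (\<Sum>k\<in>{k0..n}. 2 * (b ^ k)\<^sup>2)" by (intro sum_mono card_farey_le)
        also have "\<dots> \<le> (\<Sum>k\<le>n. 2 * (b ^ k)\<^sup>2)" by (intro sum_mono2) auto
        also have "\<dots> \<le> 4 * (b ^ n)\<^sup>2"
        proof (induction n)
          case (Suc n)
          have "2 * 2 \<le> b * b" using b2 by (intro mult_le_mono)
          then have "4 * (b ^ n)\<^sup>2 \<le> (b * b) * (b ^ n)\<^sup>2" by (intro mult_le_mono1) simp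
          also have "\<dots> = (b ^ Suc n)\<^sup>2" by (simp add: power2_eq_square)
          finally show ?case using Suc by simp
        qed simp
        finally have "card I \<le> 8 * (b ^ n)\<^sup>2" by simp
        then have "real (card I) \<le> real (8 * (b ^ n)\<^sup>2)" by (rule of_nat_mono)
        then show ?thesis by simp
      qed
      have "ennreal \<epsilon> < emeasure lborel ({0..1} - (\<Union>k\<in>{k0..}. farey_balls b k))"
        using contra by simp
      also have "\<dots> \<le> emeasure lborel ({0..1} - W n)"
        using openW by (intro emeasure_mono) (auto simp: W_def)
      also have "\<dots> \<le> ennreal (4 * \<eta> + real (card I) * (2 * ((1 + 1 / \<eta>) / (real Q)\<^sup>2)) + real (card P) * (2 / (\<eta> * (real Q)\<^sup>2)))"
        by (rule card_farey_avoiding_ge[OF _ _ Q2 \<eta> W_eq P_def]) (auto simp: I_def r_def)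
      finally have "\<epsilon> < 4 * \<eta> + real (card I) * (2 * ((1 + 1 / \<eta>) / (real Q)\<^sup>2)) + real (card P) * (2 / (\<eta> * (real Q)\<^sup>2))"
        using \<epsilon> by (metis ennreal_less_iff less_eq_real_def)
      moreover have "real (card I) * (2 * ((1 + 1 / \<eta>) / (real Q)\<^sup>2)) \<le> \<epsilon> / 4"
      proof -
        have "real (card I) * (2 * ((1 + 1 / \<eta>) / (real Q)\<^sup>2)) \<le> 8 * (real (b ^ n))\<^sup>2 * (2 * ((1 + 1 / \<eta>) / (real Q)\<^sup>2))"
          using cardI \<eta> by (intro mult_right_mono) auto
        also have "\<dots> = 16 * (1 + 1 / \<eta>) / (real b)\<^sup>2"
          using b2 by (simp add: Q_def power_mult_distrib)
        finally show ?thesis using b_large by linarith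
      qed
      moreover have "4 * \<eta> = \<epsilon> / 4" by (simp add: \<eta>_def)
      ultimately have "\<epsilon> / 2 \<le> real (card P) * (2 / (\<eta> * (real Q)\<^sup>2))" by linarith
      then have "\<epsilon>\<^sup>2 / 64 * (real Q)\<^sup>2 \<le> real (card P)"
        using \<epsilon> Q2 by (simp add: \<eta>_def field_simps power2_eq_square)
      then have "\<epsilon>\<^sup>2 / 64 * (real Q)\<^sup>2 * (2 * (1 / ((real Q)\<^sup>2 * real (Suc n)))) \<le> real (card P) * (2 * (1 / ((real Q)\<^sup>2 * real (Suc n))))"
        by (rule mult_right_mono) simp
      also have "\<epsilon>\<^sup>2 / 64 * (real Q)\<^sup>2 * (2 * (1 / ((real Q)\<^sup>2 * real (Suc n)))) = \<epsilon>\<^sup>2 / 32 / real (Suc n)"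
        using Q2 by simp
      also have "measure lborel (W n) + real (card P) * (2 * (1 / ((real Q)\<^sup>2 * real (Suc n))))
          \<le> measure lborel (W n \<union> (\<Union>p\<in>farey Q. ball p (1 / ((real Q)\<^sup>2 * real (Suc n)))))"
      proof (rule measure_Un_farey_balls_ge[OF openW W_fin _ _ _ P_def])
        \<comment> \<open>As \<open>n \<ge> k0 \<ge> 1\<close>, \<open>Suc n\<close> is at least 2;
          at level 1 the balls could overlap.\<close>
        show "2 * (1 / ((real Q)\<^sup>2 * real (Suc n))) \<le> 1 / (real Q)\<^sup>2"
        proof -
          have "2 * (1 / ((real Q)\<^sup>2 * real (Suc n))) = 2 / real (Suc n) * (1 / (real Q)\<^sup>2)" by simp
          also have "\<dots> \<le> 1 * (1 / (real Q)\<^sup>2)" using n k0 by (intro mult_right_mono) auto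
          finally show ?thesis by simp
        qed
      qed (use Q2 in auto)
      also have "W n \<union> (\<Union>p\<in>farey Q. ball p (1 / ((real Q)\<^sup>2 * real (Suc n)))) = W (Suc n)"
        using n by (simp add: W_def Q_def farey_balls_def atLeastAtMostSuc_conv Un_commute)
      finally show ?thesis by simp
    qed
    have lower: "\<epsilon>\<^sup>2 / 32 * (harm n - harm k0) \<le> measure lborel (W n)" if "n \<ge> k0" for n
      using that
    proof (induction n rule: dec_induct)
      case (step n)
      have "\<epsilon>\<^sup>2 / 32 * (harm (Suc n) - harm k0) = \<epsilon>\<^sup>2 / 32 * (harm n - harm k0) + \<epsilon>\<^sup>2 / 32 / real (Suc n)"
        by (simp only: harm_Suc inverse_eq_divide ring_distribs) simp
      then show ?case using step.IH increment[OF step.hyps(1)] by linarith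
    qed simp
    have "\<forall>\<^sub>F n in sequentially. harm n \<ge> harm k0 + 4 / (\<epsilon>\<^sup>2 / 32)"
      using harm_at_top by (simp only: filterlim_at_top)
    then have "\<forall>\<^sub>F n in sequentially. harm n \<ge> harm k0 + 4 / (\<epsilon>\<^sup>2 / 32) \<and> n \<ge> k0"
      using eventually_ge_at_top eventually_conj by blast
    then obtain n where n: "harm n \<ge> harm k0 + 4 / (\<epsilon>\<^sup>2 / 32)" "n \<ge> k0"
      by (auto simp: eventually_sequentially)
    have "4 = \<epsilon>\<^sup>2 / 32 * (4 / (\<epsilon>\<^sup>2 / 32))" using \<epsilon> by simp
    also have "\<dots> \<le> \<epsilon>\<^sup>2 / 32 * (harm n - harm k0)" using n(1) by (intro mult_left_mono) auto
    also have "\<dots> \<le> 3" using lower[OF n(2)] W3[of n] by linarith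
    finally show False by simp
  qed
  then show ?thesis using b2 by blast
qed


section \<open>From the covering to almost every number\<close>

lemma dist_nearest_int_pos:
  assumes "\<alpha> \<notin> \<rat>" "q \<ge> 1"
  shows "dist_nearest_int (real q * \<alpha>) > 0"
proof (rule ccontr)
  assume "\<not> ?thesis"
  then have "real q * \<alpha> = of_int (round (real q * \<alpha>))" by (simp add: dist_nearest_int_def)
  then have "\<alpha> = of_int (round (real q * \<alpha>)) / of_nat q" using assms(2) by (simp add: field_simps)
  then have "\<alpha> \<in> \<rat>" by (metis Rats_divide Rats_of_int Rats_of_nat)
  then show False using assms(1) by blast
qed

text \<open>Lying in level \<open>k\<close> yields some \<open>q \<le> b ^ k\<close> with
  \<open>dist_nearest_int (q * \<alpha>)\<close> at most \<open>1 / (b ^ k * k)\<close>. The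
  denominators \<open>q\<close> cannot stay bounded: by irrationality the distances for small
  \<open>q\<close> have a positive minimum \<open>m\<close>, which a large \<open>k\<close>
  undercuts.\<close>

lemma frequently_log_approx:
  assumes \<alpha>: "\<alpha> \<notin> \<rat>" and b: "b \<ge> 2" and ex: "\<And>k0. \<exists>k\<ge>k0. \<alpha> \<in> farey_balls b k"
  shows "\<exists>\<^sub>F q in sequentially. real q * dist_nearest_int (real q * \<alpha>) * ln (real q) \<le> ln (real b)"
  unfolding frequently_sequentially
proof
  fix B :: nat
  define m where "m = Min ((\<lambda>q. dist_nearest_int (real q * \<alpha>)) ` {1..Suc B})"
  have "m > 0" unfolding m_def using dist_nearest_int_pos[OF \<alpha>] by (subst Min_gr_iff) auto
  then obtain k0 where k0: "k0 > 0" "1 / real k0 < m" using nat_approx_posE by (metis zero_less_Suc)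
  obtain k where k: "k \<ge> k0" "\<alpha> \<in> farey_balls b k" using ex by blast
  obtain q a where q: "q \<ge> 1" "q \<le> b ^ k" "\<bar>real a / real q - \<alpha>\<bar> < 1 / ((real (b ^ k))\<^sup>2 * real k)"
    using k(2) by (auto simp: farey_balls_def farey_def dist_real_def)
  define Q where "Q = real (b ^ k)"
  have Q1: "Q \<ge> 1" using b by (simp add: Q_def one_le_power)
  have qQ: "real q \<le> Q" using q(2) unfolding Q_def by (rule of_nat_mono)
  have kpos: "real k > 0" using k(1) k0 by simp
  have "dist_nearest_int (real q * \<alpha>) \<le> \<bar>real q * \<alpha> - of_int (int a)\<bar>" by (rule dist_nearest_int_le)
  also have "\<dots> = real q * \<bar>real a / real q - \<alpha>\<bar>"
  proof -
    have "real q * \<alpha> - of_int (int a) = real q * - (real a / real q - \<alpha>)" using q(1) by (simp add: algebra_simps)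
    then show ?thesis by (simp only: abs_mult abs_minus_cancel abs_of_nat)
  qed
  also have "\<dots> \<le> Q * (1 / (Q\<^sup>2 * real k))"
    using q qQ Q1 unfolding Q_def[symmetric] by (intro mult_mono) auto
  also have "\<dots> = 1 / (Q * real k)" using Q1 by (simp add: power2_eq_square)
  finally have dle: "dist_nearest_int (real q * \<alpha>) \<le> 1 / (Q * real k)" .
  have "1 / (Q * real k) \<le> 1 / real k0"
  proof (rule divide_left_mono)
    have "1 * real k0 \<le> Q * real k" using Q1 k(1) by (intro mult_mono) auto
    then show "real k0 \<le> Q * real k" by simp
  qed (use Q1 kpos k0 in auto)
  then have lt: "dist_nearest_int (real q * \<alpha>) < m" using dle k0(2) by linarith
  have "q \<ge> B"
  proof (rule ccontr)
    assume "\<not> q \<ge> B"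
    then have "m \<le> dist_nearest_int (real q * \<alpha>)" using q(1) unfolding m_def by (intro Min_le) auto
    then show False using lt by linarith
  qed
  moreover have "real q * dist_nearest_int (real q * \<alpha>) * ln (real q) \<le> ln (real b)"
  proof -
    have "real q * dist_nearest_int (real q * \<alpha>) * ln (real q) \<le> Q * (1 / (Q * real k)) * (real k * ln (real b))"
    proof (intro mult_mono)
      have "ln (real q) \<le> ln Q" using q(1) qQ by simp
      also have "ln Q = real k * ln (real b)" using b by (simp add: Q_def ln_realpow)
      finally show "ln (real q) \<le> real k * ln (real b)" .
    qed (use q(1) qQ Q1 dle kpos in \<open>auto simp: dist_nearest_int_def\<close>)
    also have "\<dots> = ln (real b)" using Q1 kpos by simp
    finally show ?thesis .
  qed
  ultimately show "\<exists>q\<ge>B. real q * dist_nearest_int (real q * \<alpha>) * ln (real q) \<le> ln (real b)" by blast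
qed

text \<open>The constant \<open>C\<close> may depend on \<open>\<alpha>\<close>. It is
  \<open>ln b\<close>, where the base \<open>b\<close> is chosen according to the measure that may
  remain uncovered.\<close>

definition log_approximable :: "real \<Rightarrow> bool" where
  "log_approximable \<alpha> \<longleftrightarrow>
     (\<exists>C. \<exists>\<^sub>F q in sequentially. real q * dist_nearest_int (real q * \<alpha>) * ln (real q) \<le> C)"

text \<open>For each \<open>\<epsilon>\<close> one base \<open>b\<close> serves all starting levels.
  An exceptional \<open>\<alpha>\<close> avoids all levels beyond some \<open>k0\<close>, so it lies
  in \<open>Y k0\<close>; these sets increase with \<open>k0\<close>, and the uniform bound
  \<open>\<epsilon>\<close> passes to their union.\<close>

lemma negligible_not_log_approximable_unit:
  "negligible {\<alpha> \<in> {0..1}. \<alpha> \<notin> \<rat> \<and> \<not> log_approximable \<alpha>}" (is "negligible ?G")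
  unfolding negligible_outer_le
proof (intro allI impI)
  fix \<epsilon> :: real assume \<epsilon>: "\<epsilon> > 0"
  obtain b where b: "b \<ge> 2" and cover: "\<And>k0. k0 \<ge> 1 \<Longrightarrow> emeasure lborel ({0..1} - (\<Union>k\<in>{k0..}. farey_balls b k)) \<le> ennreal \<epsilon>"
    using farey_balls_cover[OF \<epsilon>] by blast
  define Y where "Y k0 = {0..1} - (\<Union>k\<in>{Suc k0..}. farey_balls b k)" for k0
  have Y_meas: "range Y \<subseteq> sets lborel" by (auto simp: Y_def open_farey_balls)
  have Y_inc: "incseq Y" unfolding Y_def by (intro monoI) (auto intro: Suc_leD order.trans)
  have "emeasure lborel (\<Union>k0. Y k0) = (SUP k0. emeasure lborel (Y k0))"
    using Y_meas Y_inc by (rule SUP_emeasure_incseq[symmetric])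
  also have "\<dots> \<le> ennreal \<epsilon>" unfolding Y_def by (intro SUP_least cover) auto
  finally have le: "emeasure lborel (\<Union>k0. Y k0) \<le> ennreal \<epsilon>" .
  have "?G \<subseteq> (\<Union>k0. Y k0)"
  proof
    fix \<alpha> assume \<alpha>: "\<alpha> \<in> ?G"
    have "\<not> (\<forall>k0. \<exists>k\<ge>k0. \<alpha> \<in> farey_balls b k)"
      using frequently_log_approx[of \<alpha> b] \<alpha> b unfolding log_approximable_def by blast
    then obtain k0 where "\<forall>k\<ge>k0. \<alpha> \<notin> farey_balls b k" by blast
    then have "\<alpha> \<in> Y k0" using \<alpha> by (auto simp: Y_def)
    then show "\<alpha> \<in> (\<Union>k0. Y k0)" by blast
  qed
  moreover have "(\<Union>k0. Y k0) \<in> sets lborel" using Y_meas by blast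
  then have "(\<Union>k0. Y k0) \<in> lmeasurable" "measure lebesgue (\<Union>k0. Y k0) \<le> \<epsilon>"
    using le \<epsilon> by (auto simp: fmeasurable_def measure_def le_less_trans enn2real_leI)
  ultimately show "\<exists>T. ?G \<subseteq> T \<and> T \<in> lmeasurable \<and> measure lebesgue T \<le> \<epsilon>" by blast
qed

lemma dist_nearest_int_add_int: "dist_nearest_int (t + of_int k) = dist_nearest_int t"
proof -
  have "t + of_int k + 1 / 2 = (t + 1 / 2) + of_int k" by simp
  then have "round (t + of_int k) = round t + k" unfolding round_def by (metis floor_add_int)
  then show ?thesis by (simp add: dist_nearest_int_def)
qed

lemma log_approximable_add_int: "log_approximable (\<alpha> + of_int m) = log_approximable \<alpha>"
proof -
  have "dist_nearest_int (real q * (\<alpha> + of_int m)) = dist_nearest_int (real q * \<alpha>)" for q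
    using dist_nearest_int_add_int[of "real q * \<alpha>" "int q * m"] by (simp add: algebra_simps)
  then show ?thesis by (simp add: log_approximable_def)
qed

text \<open>The property depends on \<open>\<alpha>\<close> modulo 1 only, so countably many
  translates of the exceptional set in the unit interval, together with the rationals, cover all
  exceptions.\<close>

lemma AE_log_approximable: "AE \<alpha> in lborel. \<alpha> \<notin> \<rat> \<and> log_approximable \<alpha>"
proof -
  let ?G = "{\<alpha> \<in> {0..1}. \<alpha> \<notin> \<rat> \<and> \<not> log_approximable \<alpha>}"
  have neg: "negligible (\<rat> \<union> (\<Union>m::int. (+) (of_int m) ` ?G))"
  proof (intro negligible_Un)
    show "negligible (\<rat> :: real set)" 
      using countable_imp_null_set_lborel[OF countable_rat] unfolding negligible_iff_null_sets
      by (rule null_sets_completionI)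
    show "negligible (\<Union>m::int. (+) (of_int m) ` ?G)"
    proof (rule negligible_countable_Union)
      show "negligible S" if "S \<in> range (\<lambda>m::int. (+) (of_int m) ` ?G)" for S
        using that negligible_translation[OF negligible_not_log_approximable_unit] by blast
    qed simp
  qed
  have sub: "{\<alpha>. \<not> (\<alpha> \<notin> \<rat> \<and> log_approximable \<alpha>)} \<subseteq> \<rat> \<union> (\<Union>m::int. (+) (of_int m) ` ?G)"
  proof
    fix \<alpha> assume \<alpha>: "\<alpha> \<in> {\<alpha>. \<not> (\<alpha> \<notin> \<rat> \<and> log_approximable \<alpha>)}"
    show "\<alpha> \<in> \<rat> \<union> (\<Union>m::int. (+) (of_int m) ` ?G)"
    proof (cases "\<alpha> \<in> \<rat>")
      case False
      have eq: "\<alpha> = of_int \<lfloor>\<alpha>\<rfloor> + frac \<alpha>" by (simp add: frac_def)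
      have "frac \<alpha> \<notin> \<rat>" using False eq by (metis Rats_add Rats_of_int)
      moreover have "\<not> log_approximable (frac \<alpha>)"
        using \<alpha> False log_approximable_add_int[of "frac \<alpha>" "\<lfloor>\<alpha>\<rfloor>"] eq by (simp add: add.commute)
      ultimately have "frac \<alpha> \<in> ?G" using frac_ge_0[of \<alpha>] frac_lt_1[of \<alpha>] by auto
      then show ?thesis using eq by blast
    qed blast
  qed
  have "AE \<alpha> in lebesgue. \<alpha> \<notin> \<rat> \<and> log_approximable \<alpha>"
    using neg sub by (intro AE_I'[of "\<rat> \<union> (\<Union>m::int. (+) (of_int m) ` ?G)"]) (auto simp: negligible_iff_null_sets)
  then show ?thesis by (simp add: AE_completion_iff)
qed

section \<open>Powers with slowly decreasing exponent\<close>

lemma smallest_prime_divisor_eq: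
  assumes "n \<ge> 2"
  obtains p where "prime p" "p dvd n" "smallest_prime_divisor n = ereal (real p)"
proof -
  define q where "q = (LEAST p. prime p \<and> p dvd n)"
  obtain p where "prime p \<and> p dvd n" using assms prime_factor_nat[of n] by auto
  then have "prime q \<and> q dvd n" unfolding q_def by (rule LeastI)
  moreover have "smallest_prime_divisor n = ereal (real q)"
    using assms by (simp add: smallest_prime_divisor_def q_def)
  ultimately show ?thesis using that by blast
qed

lemma rough_setI:
  assumes "n \<ge> 1" "\<And>p. prime p \<Longrightarrow> p dvd n \<Longrightarrow> f n < real p"
  shows "n \<in> rough_set f"
proof (cases "n = 1")
  case True
  then show ?thesis by (simp add: rough_set_def smallest_prime_divisor_def)
next
  case False
  then have "n \<ge> 2" using assms(1) by simp
  then obtain p where "prime p" "p dvd n" "smallest_prime_divisor n = ereal (real p)"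
    by (rule smallest_prime_divisor_eq)
  then show ?thesis using assms by (auto simp: rough_set_def)
qed

locale slow_power =
  fixes f r :: "nat \<Rightarrow> real"
  assumes f_eq: "\<And>x. 1 \<le> x \<Longrightarrow> f x = real x powr r x"
    and r_decreasing: "antimono_on {1..} r"
    and r_tendsto: "r \<longlonglongrightarrow> 0"
begin

lemma r_mono: "1 \<le> m \<Longrightarrow> m \<le> n \<Longrightarrow> r n \<le> r m"
  using monotone_onD[OF r_decreasing, of m n] by simp

lemma r_nonneg:
  assumes "n \<ge> 1"
  shows "r n \<ge> 0"
proof (rule tendsto_upperbound[OF r_tendsto])
  show "\<forall>\<^sub>F i in sequentially. r i \<le> r n"
    using eventually_ge_at_top[of n] by eventually_elim (rule r_mono[OF assms])
qed auto

lemma ln_f: "n \<ge> 1 \<Longrightarrow> ln (f n) = r n * ln (real n)"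
  using f_eq[of n] by simp

lemma f_ge_1: "n \<ge> 1 \<Longrightarrow> f n \<ge> 1"
  using f_eq[of n] r_nonneg[of n] by (simp add: ge_one_powr_ge_zero)

text \<open>From \<open>q\<close> to \<open>q\<^sup>2\<close> the exponent \<open>r\<close> does not
  grow and the logarithm at most doubles. Thus the single threshold \<open>f q\<close> squared
  controls roughness on the whole range.\<close>

lemma f_le_exp:
  assumes "1 \<le> q" "q \<le> n" "n \<le> q\<^sup>2"
  shows "f n \<le> exp (2 * ln (f q))"
proof -
  have "ln (f n) = r n * ln (real n)" using assms by (intro ln_f) simp
  also have "\<dots> \<le> r q * ln (real (q\<^sup>2))"
    using assms r_mono r_nonneg[of q]
    by (intro mult_mono ln_mono) (simp_all only: of_nat_le_iff of_nat_0_less_iff, auto)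
  also have "\<dots> = 2 * ln (f q)" using assms by (simp add: ln_f ln_realpow)
  finally have "exp (ln (f n)) \<le> exp (2 * ln (f q))" by simp
  moreover have "f n > 0" using f_ge_1[of n] assms by simp
  ultimately show ?thesis by simp
qed

lemma infinite_rough_set: "infinite (rough_set f)"
proof -
  have "\<forall>\<^sub>F n in sequentially. r n < 1" using r_tendsto by (rule order_tendstoD) simp
  then obtain n0 where n0: "\<And>n. n \<ge> n0 \<Longrightarrow> r n < 1" by (auto simp: eventually_sequentially)
  have "{p. prime p} - {..<n0} \<subseteq> rough_set f"
  proof
    fix p assume "p \<in> {p. prime p} - {..<n0}"
    then have p: "prime p" "p \<ge> n0" by auto
    have p1: "p > 1" using p(1) by (rule prime_gt_1_nat)
    have "real p powr r p < real p powr 1" using n0[OF p(2)] p1 by (intro powr_less_mono) auto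
    then have "f p < real p" using p1 by (simp add: f_eq)
    then show "p \<in> rough_set f" using p(1) p1 by (intro rough_setI) (auto dest: primes_dvd_imp_eq)
  qed
  moreover have "infinite ({p. prime p} - {..<n0})" using primes_infinite by auto
  ultimately show ?thesis using finite_subset by blast
qed

lemma zero_notin_rough_set: "0 \<notin> rough_set f"
  by (simp add: rough_set_def)

text \<open>With \<open>z\<close> the integer part of \<open>f q\<close> squared, any
  \<open>n\<close> in \<open>[q, M]\<close> whose prime divisors exceed \<open>z\<close> lies in
  \<open>rough_set f\<close>. Numbers below \<open>q\<close> may have a different threshold;
  discarding them costs the term \<open>- real q\<close>. The bound \<open>ln 2 / 2\<close> ensures
  \<open>z \<ge> 2\<close>.\<close>

lemma card_rough_set_ge:
  "\<exists>c>0. \<forall>\<^sub>F q in sequentially. \<forall>M. ln (f q) \<ge> ln 2 / 2 \<longrightarrow> q \<le> M \<longrightarrow> M \<le> q\<^sup>2 \<longrightarrow>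
     c * real M / ln (f q) - real q \<le> real (card {x \<in> rough_set f. x \<le> M})"
proof -
  obtain c C where c: "c > 0" and C: "C \<ge> 1" and
    cC: "\<And>x z. z \<ge> 2 \<Longrightarrow> C * z\<^sup>2 \<le> x \<Longrightarrow> c * real x / ln (real z) \<le> real (card (rough_upto x z))"
    using card_rough_upto_ge by metis
  \<comment> \<open>This makes \<open>z\<^sup>2 \<le> q powr (4 * r q)\<close> at most the square
    root of \<open>q\<close>; the constant \<open>C\<close> is absorbed by another square
    root.\<close>
  have "\<forall>\<^sub>F q in sequentially. r q < 1 / 8" using r_tendsto by (rule order_tendstoD) simp
  moreover have "\<forall>\<^sub>F q::nat in sequentially. real C \<le> sqrt (real q)"
    using eventually_ge_at_top[of "C\<^sup>2"]
  proof eventually_elim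
    case (elim q)
    then have "(real C)\<^sup>2 \<le> real q" by (metis of_nat_le_iff of_nat_power)
    then show ?case by (rule real_le_rsqrt)
  qed
  ultimately have "\<forall>\<^sub>F q in sequentially. \<forall>M. ln (f q) \<ge> ln 2 / 2 \<longrightarrow> q \<le> M \<longrightarrow> M \<le> q\<^sup>2 \<longrightarrow>
     c / 2 * real M / ln (f q) - real q \<le> real (card {x \<in> rough_set f. x \<le> M})"
    using eventually_ge_at_top[of 2]
  proof eventually_elim
    case (elim q)
    show ?case
    proof (intro allI impI)
      fix M assume M: "ln (f q) \<ge> ln 2 / 2" "q \<le> M" "M \<le> q\<^sup>2"
      define L where "L = ln (f q)"
      have L: "L \<ge> ln 2 / 2" using M(1) by (simp add: L_def)
      then have L0: "L > 0" by (rule less_le_trans[rotated]) simp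
      define z where "z = nat \<lfloor>exp (2 * L)\<rfloor>"
      have "2 \<le> exp (2 * L)"
      proof -
        have "exp (ln 2) \<le> exp (2 * L)" using L by (subst exp_le_cancel_iff) simp
        then show ?thesis by simp
      qed
      then have z2: "z \<ge> 2" unfolding z_def by (simp add: le_nat_floor)
      have z_le: "real z \<le> exp (2 * L)" unfolding z_def by (intro of_nat_floor) simp
      have z_gt: "exp (2 * L) < real (Suc z)" unfolding z_def by linarith
      have lnz: "ln (real z) \<le> 2 * L" using z2 ln_mono[OF z_le] by simp
      have "C * z\<^sup>2 \<le> M"
      proof -
        have q1: "real q > 1" using elim by simp
        have "(real z)\<^sup>2 \<le> (exp (2 * L))\<^sup>2" using z_le by (intro power_mono) auto
        also have "\<dots> = exp (4 * r q * ln (real q))"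
          using elim by (simp add: L_def ln_f power2_eq_square flip: exp_add)
        also have "\<dots> \<le> exp (1 / 2 * ln (real q))"
          using elim q1 by (subst exp_le_cancel_iff, intro mult_right_mono) auto
        also have "\<dots> = sqrt (real q)" using q1 by (simp add: powr_half_sqrt[symmetric] powr_def)
        finally have "real C * (real z)\<^sup>2 \<le> sqrt (real q) * sqrt (real q)"
          using elim by (intro mult_mono) auto
        also have "\<dots> = real q" by simp
        finally have "real (C * z\<^sup>2) \<le> real q" by simp
        then show ?thesis using M(2) by linarith
      qed
      then have card: "c * real M / ln (real z) \<le> real (card (rough_upto M z))" by (rule cC[OF z2])
      have "c / 2 * real M / L = c * real M / (2 * L)" by simp
      also have "\<dots> \<le> c * real M / ln (real z)"
        using c lnz z2 L0 by (intro divide_left_mono) auto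
      finally have 1: "c / 2 * real M / L \<le> real (card (rough_upto M z))" using card by linarith
      have "rough_upto M z \<subseteq> {..<q} \<union> {x \<in> rough_set f. x \<le> M}"
      proof
        fix n assume n: "n \<in> rough_upto M z"
        have "n \<in> rough_set f" if "q \<le> n"
        proof (rule rough_setI)
          fix p assume p: "prime p" "p dvd n"
          have "f n \<le> exp (2 * L)" unfolding L_def using n that elim M(3) by (intro f_le_exp) (auto simp: rough_upto_def)
          moreover have "z < p" using n p by (auto simp: rough_upto_def)
          ultimately show "f n < real p" using z_gt by linarith
        qed (use n in \<open>auto simp: rough_upto_def\<close>)
        then show "n \<in> {..<q} \<union> {x \<in> rough_set f. x \<le> M}" using n by (auto simp: rough_upto_def)
      qed
      then have "card (rough_upto M z) \<le> card ({..<q} \<union> {x \<in> rough_set f. x \<le> M})"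
        by (intro card_mono) auto
      also have "\<dots> \<le> q + card {x \<in> rough_set f. x \<le> M}" using card_Un_le[of "{..<q}"] by simp
      finally have "real (card (rough_upto M z)) \<le> real q + real (card {x \<in> rough_set f. x \<le> M})" by simp
      then show "c / 2 * real M / ln (f q) - real q \<le> real (card {x \<in> rough_set f. x \<le> M})"
        using 1 by (simp add: L_def)
    qed
  qed
  then show ?thesis using c by (intro exI[of _ "c / 2"]) auto
qed

text \<open>For such \<open>q\<close> the square of \<open>f q\<close> is below 2, so no prime
  obstructs roughness and the sequence runs through all integers of \<open>[q, 100 * q]\<close>. One
  very close pair among the first \<open>2 * q\<close> terms gives a difference
  \<open>d \<le> 3 * q\<close>, and \<open>16 * d \<le> 48 * q\<close> is below the at least
  \<open>99 * q\<close> rough numbers up to \<open>M = 100 * q\<close>.\<close>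

lemma not_poissonian_if_f_small:
  assumes "\<exists>\<^sub>F q in sequentially. ln (f q) < ln 2 / 2"
  shows "\<not> poissonian_pair_correlations (\<lambda>n. frac (real (rough_seq f n) * \<alpha>))"
proof
  let ?x = "\<lambda>n. frac (real (rough_seq f n) * \<alpha>)"
  assume poisson: "poissonian_pair_correlations ?x"
  \<comment> \<open>Chosen so that \<open>128 * (100 * q)\<close> equals
    \<open>6400 * (2 * q)\<close>: closeness \<open>s\<close> at \<open>N = 2 * q\<close> becomes
    the smallness required at \<open>M = 100 * q\<close>.\<close>
  define s :: real where "s = 1 / 6400"
  have "(\<lambda>N. real (card (close_pairs ?x N s)) / real N) \<longlonglongrightarrow> 2 * s"
    using poisson by (rule poissonian_pair_tendsto) (simp add: s_def)
  then have "\<forall>\<^sub>F N in sequentially. real (card (close_pairs ?x N s)) / real N > 0"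
    by (rule order_tendstoD) (simp add: s_def)
  then obtain N1 where N1: "\<And>N. N \<ge> N1 \<Longrightarrow> real (card (close_pairs ?x N s)) / real N > 0"
    by (auto simp: eventually_sequentially)
  have "\<exists>M d. d \<ge> 1 \<and> N0 \<le> card {x \<in> rough_set f. x \<le> M} \<and> 16 * d \<le> card {x \<in> rough_set f. x \<le> M} \<and>
            128 * (real M * dist_nearest_int (real d * \<alpha>)) \<le> 1" for N0
  proof -
    obtain q where q: "q \<ge> max (max N0 N1) 100" "ln (f q) < ln 2 / 2"
      using assms unfolding frequently_sequentially by blast
    have in_rough: "n \<in> rough_set f" if "q \<le> n" "n \<le> 100 * q" for n
    proof (rule rough_setI)
      fix p assume "prime p" "p dvd n"
      have "100 * q \<le> q\<^sup>2" using q by (simp add: power2_eq_square)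
      then have "f n \<le> exp (2 * ln (f q))" using that q by (intro f_le_exp) auto
      also have "\<dots> < exp (ln 2)" using q by (subst exp_less_cancel_iff) simp
      finally show "f n < real p" using prime_ge_2_nat[OF \<open>prime p\<close>] by simp
    qed (use that q in auto)
    have card_ge: "M - q \<le> card {x \<in> rough_set f. x \<le> M}" if "M \<le> 100 * q" for M
    proof -
      have "card {q<..M} \<le> card {x \<in> rough_set f. x \<le> M}"
        using that in_rough by (intro card_mono) auto
      then show ?thesis by simp
    qed
    let ?c = "card {x \<in> rough_set f. x \<le> 3 * q}"
    have "close_pairs ?x (2 * q) s \<noteq> {}" using N1[of "2 * q"] q by auto
    then obtain m n where mn: "m \<in> {1..2 * q}" "n \<in> {1..2 * q}" "m \<noteq> n" "real (2 * q) * \<bar>?x m - ?x n\<bar> \<le> s"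
      by (auto simp: close_pairs_def)
    have rough_le: "rough_seq f k \<le> 3 * q" if "k \<in> {1..2 * q}" for k
    proof -
      have "k \<in> {1..?c}" using that card_ge[of "3 * q"] by auto
      then show ?thesis
        using bij_betw_enumerate_upto[OF infinite_rough_set, of "3 * q"] unfolding rough_seq_def bij_betw_def by blast
    qed
    have neq: "rough_seq f m \<noteq> rough_seq f n"
    proof
      assume "rough_seq f m = rough_seq f n"
      then have "m - 1 = n - 1"
        using inj_enumerate[OF infinite_rough_set] by (auto simp: rough_seq_def inj_on_def)
      then show False using mn by auto
    qed
    have key: ?thesis if mn: "real (2 * q) * \<bar>?x m - ?x n\<bar> \<le> s" and lt: "rough_seq f m < rough_seq f n" and n: "n \<in> {1..2 * q}" for m n
    proof -
      define d where "d = rough_seq f n - rough_seq f m"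
      have d: "d \<ge> 1" "d \<le> 3 * q" using lt rough_le[OF n] by (auto simp: d_def)
      have "real d * \<alpha> - of_int (\<lfloor>real (rough_seq f n) * \<alpha>\<rfloor> - \<lfloor>real (rough_seq f m) * \<alpha>\<rfloor>) = ?x n - ?x m"
        using lt by (simp add: d_def frac_def of_nat_diff algebra_simps)
      then have "dist_nearest_int (real d * \<alpha>) \<le> \<bar>?x m - ?x n\<bar>"
        using dist_nearest_int_le[of "real d * \<alpha>" "\<lfloor>real (rough_seq f n) * \<alpha>\<rfloor> - \<lfloor>real (rough_seq f m) * \<alpha>\<rfloor>"] by simp
      then have "real (2 * q) * dist_nearest_int (real d * \<alpha>) \<le> real (2 * q) * \<bar>?x m - ?x n\<bar>"
        by (intro mult_left_mono) auto
      then have "real (2 * q) * dist_nearest_int (real d * \<alpha>) \<le> s" using mn by linarith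
      then have "128 * (real (100 * q) * dist_nearest_int (real d * \<alpha>)) \<le> 1" by (simp add: s_def)
      moreover have "100 * q - q \<le> card {x \<in> rough_set f. x \<le> 100 * q}" by (rule card_ge) simp
      ultimately show ?thesis using d q by (intro exI[of _ "100 * q"] exI[of _ d]) auto
    qed
    show ?thesis
    proof (cases "rough_seq f m < rough_seq f n")
      case True
      then show ?thesis using key mn by blast
    next
      case False
      then have "rough_seq f n < rough_seq f m" using neq by simp
      then show ?thesis using key[of n m] mn by (simp add: abs_minus_commute)
    qed
  qed
  then show False
    using not_poissonian_criterion[OF infinite_rough_set zero_notin_rough_set, of \<alpha>] poisson
    unfolding rough_seq_def by blast
qed

lemma not_poissonian_if_f_large:
  assumes large: "\<forall>\<^sub>F q in sequentially. ln (f q) \<ge> ln 2 / 2"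
    and freq: "\<And>\<epsilon>. \<epsilon> > 0 \<Longrightarrow> \<exists>\<^sub>F q in sequentially. real q * dist_nearest_int (real q * \<alpha>) * ln (f q) < \<epsilon>"
  shows "\<not> poissonian_pair_correlations (\<lambda>n. frac (real (rough_seq f n) * \<alpha>))"
  unfolding rough_seq_def
proof (rule not_poissonian_criterion[OF infinite_rough_set zero_notin_rough_set])
  fix N0 :: nat
  obtain c where c: "c > 0" and card_ev: "\<forall>\<^sub>F q in sequentially. \<forall>M. ln (f q) \<ge> ln 2 / 2 \<longrightarrow> q \<le> M \<longrightarrow> M \<le> q\<^sup>2 \<longrightarrow>
     c * real M / ln (f q) - real q \<le> real (card {x \<in> rough_set f. x \<le> M})"
    using card_rough_set_ge by blast
  \<comment> \<open>With \<open>M\<close> about \<open>K * q * L\<close>, the factor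
    \<open>17 / c\<close> gives at least \<open>17 * q - q = 16 * q\<close> rough numbers. Since
    \<open>L \<ge> 1 / 3\<close>, the 4 ensures \<open>M \<ge> q\<close>.\<close>
  define K where "K = max 4 (17 / c)"
  have K: "K \<ge> 4" "c * K \<ge> 17" using c by (auto simp: K_def field_simps max_def)
  have "\<forall>\<^sub>F q in sequentially. r q < 1" using r_tendsto by (rule order_tendstoD) simp
  moreover have "\<forall>\<^sub>F q::nat in sequentially. 2 * K * (real q * ln (real q)) \<le> (real q)\<^sup>2"
  proof -
    have "((\<lambda>q::nat. ln (real q) / real q) \<longlongrightarrow> 0) sequentially"
      using ln_x_over_x_tendsto_0 filterlim_real_sequentially by (rule filterlim_compose)
    then have "\<forall>\<^sub>F q::nat in sequentially. ln (real q) / real q < 1 / (2 * K)"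
      using K by (intro order_tendstoD) auto
    then show ?thesis
      using eventually_gt_at_top[of 0]
    proof eventually_elim
      case (elim q)
      then have "2 * K * ln (real q) \<le> real q" using K by (simp add: field_simps)
      then have "real q * (2 * K * ln (real q)) \<le> real q * real q" by (intro mult_left_mono) auto
      then show ?case by (simp add: power2_eq_square ac_simps)
    qed
  qed
  ultimately have "\<forall>\<^sub>F q in sequentially. ln (f q) \<ge> ln 2 / 2 \<and> (\<forall>M. ln (f q) \<ge> ln 2 / 2 \<longrightarrow> q \<le> M \<longrightarrow> M \<le> q\<^sup>2 \<longrightarrow>
     c * real M / ln (f q) - real q \<le> real (card {x \<in> rough_set f. x \<le> M})) \<and>
     r q < 1 \<and> 2 * K * (real q * ln (real q)) \<le> (real q)\<^sup>2 \<and> q \<ge> max N0 1"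
    (is "\<forall>\<^sub>F q in sequentially. ?good q")
    using large card_ev eventually_ge_at_top[of "max N0 1"] by (intro eventually_conj)
  \<comment> \<open>Rounding up gives \<open>M \<le> 2 * K * q * L\<close>, so this smallness yields
    exactly the bound \<open>1 / 128\<close> for
    \<open>M * dist_nearest_int (q * \<alpha>)\<close>.\<close>
  moreover have "\<exists>\<^sub>F q in sequentially. real q * dist_nearest_int (real q * \<alpha>) * ln (f q) < 1 / (256 * K)"
    (is "\<exists>\<^sub>F q in sequentially. ?small q")
    using K by (intro freq) simp
  ultimately have "\<exists>q. ?small q \<and> ?good q"
    by (intro frequently_ex[OF frequently_eventually_frequently])
  then obtain q where small: "?small q" and good: "?good q" by (elim exE conjE[where P = "?small _"])
  have L2: "ln (f q) \<ge> ln 2 / 2" and q: "r q < 1" "2 * K * (real q * ln (real q)) \<le> (real q)\<^sup>2" "q \<ge> max N0 1"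
    using good by simp_all
  have card: "c * real M / ln (f q) - real q \<le> real (card {x \<in> rough_set f. x \<le> M})" if "q \<le> M" "M \<le> q\<^sup>2" for M
    using good that by simp
  define L where "L = ln (f q)"
  define M where "M = nat \<lceil>K * real q * L\<rceil>"
  have q1: "real q \<ge> 1" using q by simp
  have L3: "L \<ge> 1 / 3" using L2 ln2_ge_two_thirds by (simp add: L_def)
  have "4 * (1 / 3) \<le> K * L" using K L3 by (intro mult_mono) auto
  then have "1 * real q \<le> (K * L) * real q" by (intro mult_right_mono) auto
  then have KqL: "K * real q * L \<ge> real q" by (simp add: ac_simps)
  have M_ge: "K * real q * L \<le> real M" unfolding M_def by (rule real_nat_ceiling_ge)
  have M_le: "real M \<le> 2 * (K * real q * L)" unfolding M_def using KqL q1 by linarith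
  have qM: "q \<le> M" using KqL M_ge by linarith
  have "L \<le> ln (real q)"
  proof -
    have "r q * ln (real q) \<le> 1 * ln (real q)" using q q1 by (intro mult_right_mono) auto
    then show ?thesis using q by (simp add: L_def ln_f)
  qed
  then have "2 * (K * real q * L) \<le> 2 * (K * real q * ln (real q))"
    using K q1 by (intro mult_left_mono) auto
  also have "\<dots> \<le> (real q)\<^sup>2" using q(2) by (simp add: ac_simps)
  finally have "real M \<le> (real q)\<^sup>2" using M_le by linarith
  then have "M \<le> q\<^sup>2" by (metis of_nat_le_iff of_nat_power)
  then have "c * real M / L - real q \<le> real (card {x \<in> rough_set f. x \<le> M})"
    using card[OF qM] by (simp add: L_def)
  moreover have "17 * real q \<le> c * real M / L"
  proof -
    have "17 * real q \<le> (c * K) * real q" using K by (intro mult_right_mono) auto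
    also have "\<dots> = c * (K * real q * L) / L" using L3 by simp
    also have "\<dots> \<le> c * real M / L" using M_ge c L3 by (intro divide_right_mono mult_left_mono) auto
    finally show ?thesis .
  qed
  ultimately have "16 * real q \<le> real (card {x \<in> rough_set f. x \<le> M})" by linarith
  then have N: "16 * q \<le> card {x \<in> rough_set f. x \<le> M}" by linarith
  have "real M * dist_nearest_int (real q * \<alpha>) \<le> 2 * (K * real q * L) * dist_nearest_int (real q * \<alpha>)"
    using M_le by (intro mult_right_mono) (auto simp: dist_nearest_int_def)
  also have "\<dots> = 2 * K * (real q * dist_nearest_int (real q * \<alpha>) * L)" by simp
  also have "\<dots> \<le> 2 * K * (1 / (256 * K))" using small K unfolding L_def by (intro mult_left_mono) auto
  also have "\<dots> = 1 / 128" using K by simp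
  finally have "128 * (real M * dist_nearest_int (real q * \<alpha>)) \<le> 1" by simp
  then show "\<exists>M d. d \<ge> 1 \<and> N0 \<le> card {x \<in> rough_set f. x \<le> M} \<and> 16 * d \<le> card {x \<in> rough_set f. x \<le> M} \<and>
            128 * (real M * dist_nearest_int (real d * \<alpha>)) \<le> 1"
    using N q(3) by (intro exI[of _ M] exI[of _ q]) auto
qed

lemma not_poissonian:
  assumes "\<And>\<epsilon>. \<epsilon> > 0 \<Longrightarrow> \<exists>\<^sub>F q in sequentially. real q * dist_nearest_int (real q * \<alpha>) * ln (f q) < \<epsilon>"
  shows "\<not> poissonian_pair_correlations (\<lambda>n. frac (real (rough_seq f n) * \<alpha>))"
proof (cases "\<exists>\<^sub>F q in sequentially. ln (f q) < ln 2 / 2")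
  case True
  then show ?thesis by (rule not_poissonian_if_f_small)
next
  case False
  then have "\<forall>\<^sub>F q in sequentially. ln (f q) \<ge> ln 2 / 2" by (simp add: not_frequently not_less)
  then show ?thesis using assms by (rule not_poissonian_if_f_large)
qed

lemma log_approximable_imp_frequently:
  assumes "log_approximable \<alpha>" "\<epsilon> > 0"
  shows "\<exists>\<^sub>F q in sequentially. real q * dist_nearest_int (real q * \<alpha>) * ln (f q) < \<epsilon>"
proof -
  obtain C where C: "\<exists>\<^sub>F q in sequentially. real q * dist_nearest_int (real q * \<alpha>) * ln (real q) \<le> C"
    using assms(1) by (auto simp: log_approximable_def)
  have "\<forall>\<^sub>F q in sequentially. r q < \<epsilon> / (\<bar>C\<bar> + 1)"
    using r_tendsto assms(2) by (intro order_tendstoD) auto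
  then have "\<forall>\<^sub>F q in sequentially. r q < \<epsilon> / (\<bar>C\<bar> + 1) \<and> q \<ge> 1"
    using eventually_ge_at_top by (rule eventually_conj)
  with C show ?thesis
  proof (rule frequently_rev_mp[OF _ eventually_mono])
    fix q assume q: "r q < \<epsilon> / (\<bar>C\<bar> + 1) \<and> q \<ge> 1"
    show "real q * dist_nearest_int (real q * \<alpha>) * ln (real q) \<le> C \<longrightarrow> real q * dist_nearest_int (real q * \<alpha>) * ln (f q) < \<epsilon>"
    proof
      assume le: "real q * dist_nearest_int (real q * \<alpha>) * ln (real q) \<le> C"
      have "real q * dist_nearest_int (real q * \<alpha>) * ln (f q) = r q * (real q * dist_nearest_int (real q * \<alpha>) * ln (real q))"
        using q by (simp add: ln_f)
      also have "\<dots> \<le> r q * (\<bar>C\<bar> + 1)" using le r_nonneg q by (intro mult_left_mono) auto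
      also have "\<dots> < \<epsilon> / (\<bar>C\<bar> + 1) * (\<bar>C\<bar> + 1)" using q by (intro mult_strict_right_mono) auto
      also have "\<dots> = \<epsilon>" by (simp add: field_simps)
      finally show "real q * dist_nearest_int (real q * \<alpha>) * ln (f q) < \<epsilon>" .
    qed
  qed
qed

end

lemma liminf_zero_imp_frequently:
  fixes u :: "nat \<Rightarrow> real"
  assumes "liminf (\<lambda>n. ereal (u n)) = 0" "\<epsilon> > 0"
  shows "\<exists>\<^sub>F n in sequentially. u n < \<epsilon>"
proof (rule ccontr)
  assume "\<not> ?thesis"
  then have "\<forall>\<^sub>F n in sequentially. ereal \<epsilon> \<le> ereal (u n)" by (simp add: not_frequently not_less)
  then have "ereal \<epsilon> \<le> liminf (\<lambda>n. ereal (u n))" by (rule Liminf_bounded)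
  then show False using assms by simp
qed

theorem theorem2:
  fixes f r :: "nat \<Rightarrow> real"
  assumes f_eq: "\<And>x. 1 \<le> x \<Longrightarrow> f x = real x powr r x"
    and r_decreasing: "antimono_on {1..} r"
    and r_tendsto: "r \<longlonglongrightarrow> 0"
  shows "(\<forall>\<alpha>::real. \<alpha> \<notin> \<rat> \<longrightarrow>
            liminf (\<lambda>n. ereal (real n * dist_nearest_int (real n * \<alpha>) * ln (f n))) = 0 \<longrightarrow>
            \<not> poissonian_pair_correlations (\<lambda>n. frac (real (rough_seq f n) * \<alpha>)))
       \<and> (AE \<alpha> in lborel.
            \<not> poissonian_pair_correlations (\<lambda>n. frac (real (rough_seq f n) * \<alpha>)) \<and>
            \<not> (\<forall>k\<ge>2. poissonian_correlations k (\<lambda>n. frac (real (rough_seq f n) * \<alpha>))))"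
proof -
  interpret slow_power f r using assms by (unfold_locales) auto
  show ?thesis
  proof (intro conjI allI impI)
    show "\<not> poissonian_pair_correlations (\<lambda>n. frac (real (rough_seq f n) * \<alpha>))"
      if "liminf (\<lambda>n. ereal (real n * dist_nearest_int (real n * \<alpha>) * ln (f n))) = 0" for \<alpha>
      using liminf_zero_imp_frequently[OF that] by (rule not_poissonian)
    show "AE \<alpha> in lborel. \<not> poissonian_pair_correlations (\<lambda>n. frac (real (rough_seq f n) * \<alpha>)) \<and>
            \<not> (\<forall>k\<ge>2. poissonian_correlations k (\<lambda>n. frac (real (rough_seq f n) * \<alpha>)))"
      using AE_log_approximable
    proof (rule AE_mp, intro AE_I2 impI)
      fix \<alpha> assume "\<alpha> \<notin> \<rat> \<and> log_approximable \<alpha>"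
      then have "\<not> poissonian_pair_correlations (\<lambda>n. frac (real (rough_seq f n) * \<alpha>))"
        using not_poissonian log_approximable_imp_frequently by blast
      then show "\<not> poissonian_pair_correlations (\<lambda>n. frac (real (rough_seq f n) * \<alpha>)) \<and>
            \<not> (\<forall>k\<ge>2. poissonian_correlations k (\<lambda>n. frac (real (rough_seq f n) * \<alpha>)))"
        by blast
    qed
  qed
qed

end
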